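(* Let $\mathcal{L}$ be an operator on $\mathbb{R}^n$ satisfying the standing assumptions listed in the context. Let $\lambda\ge 0$ be a real number and let $u\in C^2(\mathbb{R}^n,\mathbb{R})\cap L^2(\mathbb{R}^n)$ be such that $\mathcal{L}u=\lambda u$ in $\mathbb{R}^n$. Then $u\equiv 0$.
   Context: Standing assumptions. $\mathcal{L}:=\mathrm{div}(A\nabla)+\langle b,\nabla\rangle$ is a linear second order partial differential operator on $\mathbb{R}^n$, where $A=(a_{ij})_{i,j=1,\dots,n}$ is a symmetric $n\times n$ matrix with entries $a_{ij}\in C^\infty(\mathbb{R}^n,\mathbb{R})$, $b=(b_1,\dots,b_n)$ has components $b_j\in C^\infty(\mathbb{R}^n,\mathbb{R})$, and $\mathrm{div}$, $\nabla$, $\langle\cdot,\cdot\rangle$ are the Euclidean divergence, gradient and inner product. It is assumed that $\langle A(x)\xi,\xi\rangle\ge 0$ for all $x,\xi\in\mathbb{R}^n$ and $\mathrm{trace}\,A(0)>0$. Moreover: (1) $\mathcal{L}$ is hypoelliptic: if $w$ is a distribution on an open set $\Omega\subseteq\mathbb{R}^n$ and $\mathcal{L}w$ is smooth in $\Omega$, then $w$ is smooth in $\Omega$. (2) There is a Lie group $\mathbb{G}=(\mathbb{R}^n,\circ)$ such that $\mathcal{L}$ is left translation invariant on $\mathbb{G}$, i.e. $\mathcal{L}(w(\alpha\circ\cdot))(x)=(\mathcal{L}w)(\alpha\circ x)$ for all $\alpha,x\in\mathbb{R}^n$ and all $w\in C^\infty(\mathbb{R}^n,\mathbb{R})$. (3)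 The Lebesgue measure on $\mathbb{R}^n$ is both left and right invariant on $\mathbb{G}$. $L^2$ is taken with respect to Lebesgue measure. *)

theory Defs
  imports "HOL-Analysis.Analysis"
begin

definition dir_deriv ::
  "'a::euclidean_space \<Rightarrow> ('a \<Rightarrow> 'b::real_normed_vector) \<Rightarrow> 'a \<Rightarrow> 'b"
  where "dir_deriv v f x = frechet_derivative f (at x) v"

text \<open>
  The set \<open>S\<close> is always meant to be open, so that derivatives are taken at interior points.
  At order \<open>Suc k\<close>, differentiability on \<open>S\<close> makes all partial derivatives meaningful,
  and these are required to be of class \<open>C^k\<close>.
\<close>
primrec Ck_on ::
  "nat \<Rightarrow> 'a::euclidean_space set \<Rightarrow> ('a \<Rightarrow> 'b::real_normed_vector) \<Rightarrow> bool"
  where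
    "Ck_on 0 S f \<longleftrightarrow> continuous_on S f"
  | "Ck_on (Suc k) S f \<longleftrightarrow>
       (\<forall>x\<in>S. f differentiable (at x)) \<and> (\<forall>v\<in>Basis. Ck_on k S (dir_deriv v f))"

definition smooth_on ::
  "'a::euclidean_space set \<Rightarrow> ('a \<Rightarrow> 'b::real_normed_vector) \<Rightarrow> bool"
  where "smooth_on S f \<longleftrightarrow> (\<forall>k. Ck_on k S f)"

text \<open>Iterated partial derivatives; a list of basis vectors plays the role of a multi-index.\<close>
primrec iter_deriv ::
  "'a::euclidean_space list \<Rightarrow> ('a \<Rightarrow> 'b::real_normed_vector) \<Rightarrow> 'a \<Rightarrow> 'b"
  where
    "iter_deriv [] f = f"
  | "iter_deriv (v # vs) f = dir_deriv v (iter_deriv vs f)"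

definition grad :: "(real^'n \<Rightarrow> real) \<Rightarrow> real^'n \<Rightarrow> real^'n"
  where "grad f x = (\<chi> i. dir_deriv (axis i 1) f x)"

definition divergence :: "(real^'n \<Rightarrow> real^'n) \<Rightarrow> real^'n \<Rightarrow> real"
  where "divergence F x = (\<Sum>i\<in>UNIV. dir_deriv (axis i 1) (\<lambda>y. F y $ i) x)"

definition diff_op ::
  "(real^'n \<Rightarrow> real^'n^'n) \<Rightarrow> (real^'n \<Rightarrow> real^'n) \<Rightarrow> (real^'n \<Rightarrow> real) \<Rightarrow> real^'n \<Rightarrow> real"
  where "diff_op A b u x = divergence (\<lambda>y. A y *v grad u y) x + b x \<bullet> grad u x"

text \<open>
  The formal adjoint of \<^const>\<open>diff_op\<close> with respect to Lebesgue measure, for symmetric \<open>A\<close>,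
  obtained by integrating by parts against a test function.
\<close>
definition diff_op_adjoint ::
  "(real^'n \<Rightarrow> real^'n^'n) \<Rightarrow> (real^'n \<Rightarrow> real^'n) \<Rightarrow> (real^'n \<Rightarrow> real) \<Rightarrow> real^'n \<Rightarrow> real"
  where "diff_op_adjoint A b \<phi> x =
    divergence (\<lambda>y. A y *v grad \<phi> y) x - divergence (\<lambda>y. \<phi> y *\<^sub>R b y) x"

definition test_function :: "'a::euclidean_space set \<Rightarrow> ('a \<Rightarrow> real) \<Rightarrow> bool"
  where "test_function \<Omega> \<phi> \<longleftrightarrow> smooth_on UNIV \<phi> \<and>
    compact (closure (support_on UNIV \<phi>)) \<and> closure (support_on UNIV \<phi>) \<subseteq> \<Omega>"

text \<open>
  A distribution on \<open>\<Omega>\<close> is represented by a functional on all functions, of which only the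
  values on the test functions of \<open>\<Omega>\<close> matter. Continuity is expressed by the usual seminorm
  estimates on each compact subset of \<open>\<Omega>\<close>.
\<close>
definition distribution_on :: "'a::euclidean_space set \<Rightarrow> (('a \<Rightarrow> real) \<Rightarrow> real) \<Rightarrow> bool"
  where "distribution_on \<Omega> T \<longleftrightarrow>
    (\<forall>\<phi> \<psi>. test_function \<Omega> \<phi> \<longrightarrow> test_function \<Omega> \<psi> \<longrightarrow>
        T (\<lambda>x. \<phi> x + \<psi> x) = T \<phi> + T \<psi>) \<and>
    (\<forall>c \<phi>. test_function \<Omega> \<phi> \<longrightarrow> T (\<lambda>x. c * \<phi> x) = c * T \<phi>) \<and>
    (\<forall>K. compact K \<and> K \<subseteq> \<Omega> \<longrightarrow>
      (\<exists>C N. \<forall>\<phi>. test_function \<Omega> \<phi> \<and> closure (support_on UNIV \<phi>) \<subseteq> K \<longrightarrow>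
        \<bar>T \<phi>\<bar> \<le> C * (\<Sum>vs | set vs \<subseteq> Basis \<and> length vs \<le> N.
                         SUP x. \<bar>iter_deriv vs \<phi> x\<bar>)))"

definition smooth_distribution_on ::
  "'a::euclidean_space set \<Rightarrow> (('a \<Rightarrow> real) \<Rightarrow> real) \<Rightarrow> bool"
  where "smooth_distribution_on \<Omega> T \<longleftrightarrow>
    (\<exists>f. smooth_on \<Omega> f \<and>
      (\<forall>\<phi>. test_function \<Omega> \<phi> \<longrightarrow> T \<phi> = (LINT x:\<Omega>|lebesgue. f x * \<phi> x)))"

definition diff_op_distr ::
  "(real^'n \<Rightarrow> real^'n^'n) \<Rightarrow> (real^'n \<Rightarrow> real^'n) \<Rightarrow>
   ((real^'n \<Rightarrow> real) \<Rightarrow> real) \<Rightarrow> (real^'n \<Rightarrow> real) \<Rightarrow> real"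
  where "diff_op_distr A b T \<phi> = T (diff_op_adjoint A b \<phi>)"

definition hypoelliptic :: "(real^'n \<Rightarrow> real^'n^'n) \<Rightarrow> (real^'n \<Rightarrow> real^'n) \<Rightarrow> bool"
  where "hypoelliptic A b \<longleftrightarrow>
    (\<forall>\<Omega> T. open \<Omega> \<longrightarrow> distribution_on \<Omega> T \<longrightarrow>
       smooth_distribution_on \<Omega> (diff_op_distr A b T) \<longrightarrow> smooth_distribution_on \<Omega> T)"

text \<open>The identity element is not required to be the origin.\<close>
definition lie_group :: "('a::euclidean_space \<Rightarrow> 'a \<Rightarrow> 'a) \<Rightarrow> bool"
  where "lie_group mul \<longleftrightarrow>
    (\<exists>e iv. group mul e iv \<and> smooth_on UNIV (\<lambda>(x, y). mul x y) \<and> smooth_on UNIV iv)"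

definition left_translation_invariant ::
  "(real^'n \<Rightarrow> real^'n \<Rightarrow> real^'n) \<Rightarrow> ((real^'n \<Rightarrow> real) \<Rightarrow> real^'n \<Rightarrow> real) \<Rightarrow> bool"
  where "left_translation_invariant mul L \<longleftrightarrow>
    (\<forall>\<alpha> x w. smooth_on UNIV w \<longrightarrow> L (\<lambda>y. w (mul \<alpha> y)) x = L w (mul \<alpha> x))"

definition left_invariant_measure :: "('a \<Rightarrow> 'a \<Rightarrow> 'a) \<Rightarrow> 'a measure \<Rightarrow> bool"
  where "left_invariant_measure mul M \<longleftrightarrow>
    (\<forall>\<alpha>. \<forall>E\<in>sets M. (\<lambda>x. mul \<alpha> x) ` E \<in> sets M \<and>
       emeasure M ((\<lambda>x. mul \<alpha> x) ` E) = emeasure M E)"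

definition right_invariant_measure :: "('a \<Rightarrow> 'a \<Rightarrow> 'a) \<Rightarrow> 'a measure \<Rightarrow> bool"
  where "right_invariant_measure mul M \<longleftrightarrow>
    (\<forall>\<alpha>. \<forall>E\<in>sets M. (\<lambda>x. mul x \<alpha>) ` E \<in> sets M \<and>
       emeasure M ((\<lambda>x. mul x \<alpha>) ` E) = emeasure M E)"

definition square_integrable :: "'a measure \<Rightarrow> ('a \<Rightarrow> real) \<Rightarrow> bool"
  where "square_integrable M u \<longleftrightarrow> u \<in> borel_measurable M \<and> integrable M (\<lambda>x. (u x)\<^sup>2)"

end

theory Submission
  imports Defs
begin

text \<open>
  With \<open>L = diff_op A b\<close> and \<open>v = u\<^sup>2\<close> one has \<open>L v = 2 lam u\<^sup>2 + 2 (A \<nabla>u) \<bullet> \<nabla>u \<ge> 0\<close>. Since \<open>v\<close> is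
  integrable, averaging \<open>L v\<close> over all left translations, with Fubini's theorem and right
  invariance, shows that its total mass is zero, so both terms vanish. If \<open>lam > 0\<close> this
  gives \<open>u = 0\<close>. If \<open>lam = 0\<close>, then \<open>A \<nabla>u = 0\<close> and hence \<open>b \<bullet> \<nabla>u = 0\<close>, so that \<open>F \<circ> u\<close> solves
  \<open>L (F \<circ> u) = 0\<close> weakly for every \<open>F\<close> of class \<open>C^1\<close>. Hypoellipticity makes all of these smooth,
  including those with nonsmooth \<open>F\<close>, which forces \<open>\<nabla>u = 0\<close>; a constant in \<open>L^2\<close> is zero.
\<close>

subsection \<open>Functions of class \<open>C^k\<close>\<close>

text \<open>Nothing controls the derivatives of \<open>v\<close> at infinity, so \<open>L v\<close>
  cannot be integrated directly; its derivatives are first moved onto a compactly supported bump.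
  Left translations carry the bump because they commute with \<open>L\<close>, and right invariance
  enters because, for fixed y, the map taking \<alpha> to the product of \<alpha> and y is a right
  translation. Left invariance is assumed for smooth functions while \<open>v\<close> is only C^2;
  since \<open>L\<close> at a point sees only derivatives up to order two, a smooth function with
  the same derivatives can stand in for \<open>v\<close> there. For \<open>lam = 0\<close>, F must
  be C^1, so that one integration by parts makes sense, but not twice differentiable at c = u x.
  With F(t) = (t - c) |t - c|, smoothness of F(u) near a point with \<nabla>u \<noteq> 0 would make
  |u - c| differentiable at its minimum.\<close>

lemma dir_deriv_eqI: "(f has_derivative f') (at x) \<Longrightarrow> dir_deriv v f x = f' v"
  unfolding dir_deriv_def by (metis frechet_derivative_at)

lemma has_derivative_dir_deriv:
  "f differentiable (at x) \<Longrightarrow> (f has_derivative (\<lambda>v. dir_deriv v f x)) (at x)"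
  unfolding dir_deriv_def by (simp add: frechet_derivative_works[symmetric])

lemma dir_deriv_const [simp]: "dir_deriv v (\<lambda>_. c) = (\<lambda>_. 0)"
  by (intro ext) (simp add: dir_deriv_eqI[OF has_derivative_const])

lemma dir_deriv_bounded_linear: "bounded_linear h \<Longrightarrow> dir_deriv v h = (\<lambda>_. h v)"
  by (intro ext) (simp add: dir_deriv_eqI[OF bounded_linear_imp_has_derivative])

lemma dir_deriv_add:
  assumes "f differentiable (at x)" "g differentiable (at x)"
  shows "dir_deriv v (\<lambda>x. f x + g x) x = dir_deriv v f x + dir_deriv v g x"
  by (rule dir_deriv_eqI[OF has_derivative_add[OF assms[THEN has_derivative_dir_deriv]]])

lemma dir_deriv_sum:
  assumes "\<And>i. i \<in> I \<Longrightarrow> f i differentiable (at x)"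
  shows "dir_deriv v (\<lambda>x. \<Sum>i\<in>I. f i x) x = (\<Sum>i\<in>I. dir_deriv v (f i) x)"
  by (rule dir_deriv_eqI[OF has_derivative_sum[OF has_derivative_dir_deriv[OF assms]]])

lemma dir_deriv_mult:
  fixes f g :: "'a::euclidean_space \<Rightarrow> real"
  assumes "f differentiable (at x)" "g differentiable (at x)"
  shows "dir_deriv v (\<lambda>x. f x * g x) x = f x * dir_deriv v g x + dir_deriv v f x * g x"
  by (rule dir_deriv_eqI[OF has_derivative_mult[OF assms[THEN has_derivative_dir_deriv]]])

lemma dir_deriv_compose_bounded_linear:
  assumes "bounded_linear h" "f differentiable (at x)"
  shows "dir_deriv v (\<lambda>x. h (f x)) x = h (dir_deriv v f x)"
  by (rule dir_deriv_eqI[OF bounded_linear.has_derivative[OF assms(1) has_derivative_dir_deriv[OF assms(2)]]])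

lemma dir_deriv_eq_sum_Basis:
  assumes "f differentiable (at x)"
  shows "dir_deriv v f x = (\<Sum>e\<in>Basis. (v \<bullet> e) *\<^sub>R dir_deriv e f x)"
proof -
  interpret linear "\<lambda>v. dir_deriv v f x"
    using has_derivative_dir_deriv[OF assms] has_derivative_linear by blast
  have "dir_deriv v f x = dir_deriv (\<Sum>e\<in>Basis. (v \<bullet> e) *\<^sub>R e) f x"
    by (simp add: euclidean_representation)
  also have "\<dots> = (\<Sum>e\<in>Basis. (v \<bullet> e) *\<^sub>R dir_deriv e f x)"
    by (simp add: sum scale)
  finally show ?thesis .
qed

lemma dir_deriv_compose:
  fixes f :: "'b::euclidean_space \<Rightarrow> 'c::real_normed_vector"
  assumes "f differentiable (at (g x))" "g differentiable (at x)"
  shows "dir_deriv v (\<lambda>x. f (g x)) x = (\<Sum>e\<in>Basis. (dir_deriv v g x \<bullet> e) *\<^sub>R dir_deriv e f (g x))"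
proof -
  have "dir_deriv v (\<lambda>x. f (g x)) x = dir_deriv (dir_deriv v g x) f (g x)"
    by (rule dir_deriv_eqI[OF has_derivative_compose[OF has_derivative_dir_deriv[OF assms(2)]
            has_derivative_dir_deriv[OF assms(1)]]])
  then show ?thesis
    by (rule trans[OF _ dir_deriv_eq_sum_Basis[OF assms(1)]])
qed

lemma Ck_on_Suc_imp: "Ck_on (Suc k) S f \<Longrightarrow> Ck_on k S f"
proof (induction k arbitrary: f)
  case 0
  then show ?case
    by (auto intro!: differentiable_imp_continuous_on differentiable_at_imp_differentiable_on)
next
  case (Suc k)
  have "Ck_on k S (dir_deriv v f)" if "v \<in> Basis" for v
    using Suc.prems that by (intro Suc.IH) (subst (asm) Ck_on.simps(2), blast)
  with Suc.prems show ?case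
    unfolding Ck_on.simps(2)[of _ S f] by blast
qed

lemma Ck_on_mono: "Ck_on k S f \<Longrightarrow> m \<le> k \<Longrightarrow> Ck_on m S f"
proof (induction k)
  case (Suc k)
  then show ?case
    using Ck_on_Suc_imp[of k S f] by (cases "m = Suc k") simp_all
qed simp

lemma Ck_on_imp_differentiable: "Ck_on k UNIV f \<Longrightarrow> 0 < k \<Longrightarrow> f differentiable (at x)"
  by (cases k) auto

lemma Ck_on_imp_continuous: "Ck_on k S f \<Longrightarrow> continuous_on S f"
  using Ck_on_mono[of k S f 0] by simp

lemma Ck_on_const [simp]: "Ck_on k UNIV (\<lambda>_. c)"
  by (induction k arbitrary: c) auto

lemma Ck_on_bounded_linear: "bounded_linear h \<Longrightarrow> Ck_on k UNIV h"
  by (cases k) (auto simp: dir_deriv_bounded_linear linear_continuous_on bounded_linear_imp_differentiable)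

lemma Ck_on_add: "Ck_on k UNIV f \<Longrightarrow> Ck_on k UNIV g \<Longrightarrow> Ck_on k UNIV (\<lambda>x. f x + g x)"
proof (induction k arbitrary: f g)
  case (Suc k)
  then have "dir_deriv v (\<lambda>x. f x + g x) = (\<lambda>x. dir_deriv v f x + dir_deriv v g x)" for v
    by (intro ext dir_deriv_add) auto
  with Suc show ?case by auto
qed (auto intro: continuous_on_add)

lemma Ck_on_sum:
  "(\<And>i. i \<in> I \<Longrightarrow> Ck_on k UNIV (f i)) \<Longrightarrow> Ck_on k UNIV (\<lambda>x. \<Sum>i\<in>I. f i x)"
  by (induction I rule: infinite_finite_induct) (auto intro: Ck_on_add)

lemma Ck_on_mult:
  fixes f g :: "'a::euclidean_space \<Rightarrow> real"
  shows "Ck_on k UNIV f \<Longrightarrow> Ck_on k UNIV g \<Longrightarrow> Ck_on k UNIV (\<lambda>x. f x * g x)"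
proof (induction k arbitrary: f g)
  case (Suc k)
  then have "dir_deriv v (\<lambda>x. f x * g x) = (\<lambda>x. f x * dir_deriv v g x + dir_deriv v f x * g x)" for v
    by (intro ext dir_deriv_mult) auto
  moreover have "Ck_on k UNIV f" "Ck_on k UNIV g"
    using Suc.prems by (simp_all only: Ck_on_Suc_imp)
  ultimately show ?case
    using Suc.prems by (auto intro!: Ck_on_add Suc.IH differentiable_mult)
qed (auto intro: continuous_on_mult)

lemma Ck_on_minus:
  fixes f :: "'a::euclidean_space \<Rightarrow> real"
  shows "Ck_on k UNIV f \<Longrightarrow> Ck_on k UNIV (\<lambda>x. - f x)"
  using Ck_on_mult[of k "\<lambda>_. -1" f] by simp

lemma Ck_on_diff:
  fixes f g :: "'a::euclidean_space \<Rightarrow> real"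
  shows "Ck_on k UNIV f \<Longrightarrow> Ck_on k UNIV g \<Longrightarrow> Ck_on k UNIV (\<lambda>x. f x - g x)"
  using Ck_on_add[of k f "\<lambda>x. - g x"] Ck_on_minus[of k g] by simp

lemma Ck_on_compose_bounded_linear:
  assumes "bounded_linear h"
  shows "Ck_on k UNIV f \<Longrightarrow> Ck_on k UNIV (\<lambda>x. h (f x))"
proof (induction k arbitrary: f)
  case 0
  then show ?case
    using bounded_linear.continuous_on[OF assms] by auto
next
  case (Suc k)
  then have "dir_deriv v (\<lambda>x. h (f x)) = (\<lambda>x. h (dir_deriv v f x))" for v
    by (intro ext dir_deriv_compose_bounded_linear assms) auto
  with Suc show ?case
    using bounded_linear_imp_differentiable[OF assms]
    by (auto intro: differentiable_compose)
qed

lemma Ck_on_inner_const: "Ck_on k UNIV f \<Longrightarrow> Ck_on k UNIV (\<lambda>x. f x \<bullet> e)"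
  by (rule Ck_on_compose_bounded_linear[OF bounded_linear_inner_left])

lemma Ck_on_vec_nth: "Ck_on k UNIV f \<Longrightarrow> Ck_on k UNIV (\<lambda>x. f x $ i)"
  by (rule Ck_on_compose_bounded_linear[OF bounded_linear_vec_nth])

text \<open>In the chain rule each term keeps the inner map \<open>g\<close> and replaces
  \<open>f\<close> by one of its partials, so only \<open>f\<close> is generalized in the
  induction.\<close>

lemma Ck_on_compose:
  fixes f :: "'b::euclidean_space \<Rightarrow> real"
  shows "Ck_on k UNIV f \<Longrightarrow> Ck_on k UNIV g \<Longrightarrow> Ck_on k UNIV (\<lambda>x. f (g x))"
proof (induction k arbitrary: f)
  case 0
  then show ?case
    using continuous_on_compose2 by force
next
  case (Suc k)
  have eq: "dir_deriv v (\<lambda>x. f (g x)) = (\<lambda>x. \<Sum>e\<in>Basis. (dir_deriv v g x \<bullet> e) *\<^sub>R dir_deriv e f (g x))" for v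
    using Suc.prems by (intro ext dir_deriv_compose) auto
  have "Ck_on k UNIV (\<lambda>x. dir_deriv e f (g x))" if "e \<in> Basis" for e
    using Suc.prems that by (intro Suc.IH) (auto simp only: Ck_on.simps(2) Ck_on_Suc_imp)
  then have "Ck_on k UNIV (dir_deriv v (\<lambda>x. f (g x)))" if "v \<in> Basis" for v
    unfolding eq real_scaleR_def using that Suc.prems(2)
    by (intro Ck_on_sum Ck_on_mult Ck_on_inner_const) auto
  then show ?case
    using Suc.prems by (auto intro: differentiable_compose)
qed

text \<open>Turns joint smoothness of the group law into smoothness of each left translation.
  Partials in the second slot are partials along (0, v), again basis directions of the product, so
  the induction closes.\<close>

lemma Ck_on_fix_left:
  fixes f :: "'a::euclidean_space \<times> 'b::euclidean_space \<Rightarrow> 'c::real_normed_vector"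
  shows "Ck_on k UNIV f \<Longrightarrow> Ck_on k UNIV (\<lambda>y. f (a, y))"
proof (induction k arbitrary: f)
  case 0
  then show ?case
    by (auto intro!: continuous_on_compose2[of UNIV f] continuous_intros)
next
  case (Suc k)
  have d: "((\<lambda>y. (a, y)) has_derivative (\<lambda>v. (0, v))) (at y)" for y :: 'b
    by (auto intro!: derivative_eq_intros)
  have "dir_deriv v (\<lambda>y. f (a, y)) = (\<lambda>y. dir_deriv (0, v) f (a, y))" for v
  proof
    fix y
    show "dir_deriv v (\<lambda>y. f (a, y)) y = dir_deriv (0, v) f (a, y)"
      using Suc.prems
      by (intro dir_deriv_eqI[OF has_derivative_compose[OF d has_derivative_dir_deriv]]) auto
  qed
  moreover have "(\<lambda>y. f (a, y)) differentiable (at y)" for y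
    using has_derivative_compose[OF d has_derivative_dir_deriv[of f]] Suc.prems
    by (auto simp: differentiable_def)
  ultimately show ?case
    using Suc by (auto simp: Basis_prod_def)
qed

lemma smooth_onD: "smooth_on S f \<Longrightarrow> Ck_on k S f"
  by (simp add: smooth_on_def)

subsection \<open>Integration of derivatives\<close>

lemma dir_deriv_eq_0_outside:
  assumes "closed K" "\<And>x. x \<notin> K \<Longrightarrow> f x = 0" "x \<notin> K"
  shows "dir_deriv v f x = 0"
proof -
  have "(f has_derivative (\<lambda>_. 0)) (at x)"
    using assms by (intro has_derivative_transform_within_open[OF has_derivative_const, of "-K"]) auto
  then show ?thesis by (rule dir_deriv_eqI)
qed

lemma bounded_of_compact_support:
  fixes f :: "'a::euclidean_space \<Rightarrow> real"
  assumes "continuous_on UNIV f" "compact K" "\<And>x. x \<notin> K \<Longrightarrow> f x = 0"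
  obtains B where "0 \<le> B" "\<And>x. \<bar>f x\<bar> \<le> B"
proof -
  have "bounded (f ` K)"
    using assms by (intro compact_imp_bounded compact_continuous_image) (auto intro: continuous_on_subset)
  then obtain B where B: "\<And>x. x \<in> K \<Longrightarrow> \<bar>f x\<bar> \<le> B"
    unfolding bounded_iff by auto
  show thesis
  proof
    show "0 \<le> max 0 B" by simp
    show "\<bar>f x\<bar> \<le> max 0 B" for x
      using B assms(3)[of x] by (cases "x \<in> K") (auto intro: le_max_iff_disj[THEN iffD2])
  qed
qed

lemma integrable_of_compact_support:
  fixes f :: "'a::euclidean_space \<Rightarrow> real"
  assumes "continuous_on UNIV f" "compact K" "\<And>x. x \<notin> K \<Longrightarrow> f x = 0"
  shows "integrable lborel f"
proof -
  have "integrable lborel (\<lambda>x. indicator K x *\<^sub>R f x)"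
    using assms by (intro borel_integrable_compact) (auto intro: continuous_on_subset)
  also have "(\<lambda>x. indicator K x *\<^sub>R f x) = f"
    using assms(3) by (intro ext) (auto simp: indicator_def)
  finally show ?thesis .
qed

lemma integral_lborel_translate:
  fixes f :: "'a::euclidean_space \<Rightarrow> real"
  assumes "f \<in> borel_measurable borel"
  shows "(\<integral>x. f (x + a) \<partial>lborel) = (\<integral>x. f x \<partial>lborel)"
proof -
  have "(\<integral>x. f x \<partial>lborel) = (\<integral>x. f x \<partial>distr lborel borel ((+) a))"
    by (simp add: lborel_distr_plus)
  also have "\<dots> = (\<integral>x. f (a + x) \<partial>lborel)"
    using assms by (intro integral_distr) auto
  finally show ?thesis by (simp add: add.commute)
qed

lemma DERIV_along_line:
  assumes "h differentiable (at (x + t *\<^sub>R v))"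
  shows "((\<lambda>t. h (x + t *\<^sub>R v)) has_real_derivative dir_deriv v h (x + t *\<^sub>R v)) (at t)"
proof -
  have D: "(h has_derivative (\<lambda>v'. dir_deriv v' h (x + t *\<^sub>R v))) (at (x + t *\<^sub>R v))"
    using assms by (rule has_derivative_dir_deriv)
  interpret linear "\<lambda>v'. dir_deriv v' h (x + t *\<^sub>R v)"
    using D has_derivative_linear by blast
  have "((\<lambda>t. x + t *\<^sub>R v) has_derivative (\<lambda>s. s *\<^sub>R v)) (at t)"
    by (auto intro!: derivative_eq_intros)
  from has_derivative_compose[OF this D] show ?thesis
    unfolding has_field_derivative_def by (rule has_derivative_eq_rhs) (auto simp: scale)
qed

text \<open>The derivative is the limit of difference quotients in direction \<open>v\<close>, each
  of which has integral zero by translation invariance of Lebesgue measure; dominated convergence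
  carries this to the limit.\<close>

lemma integral_dir_deriv_eq_0:
  fixes h :: "'a::euclidean_space \<Rightarrow> real"
  assumes diff: "\<And>x. h differentiable (at x)" and cont: "continuous_on UNIV (dir_deriv v h)"
    and K: "compact K" "\<And>x. x \<notin> K \<Longrightarrow> h x = 0"
  shows "(\<integral>x. dir_deriv v h x \<partial>lborel) = 0"
proof -
  have cont_h: "continuous_on UNIV h"
    using diff by (simp add: continuous_at_imp_continuous_on differentiable_imp_continuous_within)
  then have [measurable]: "h \<in> borel_measurable borel"
    by (rule borel_measurable_continuous_onI)
  have [measurable]: "dir_deriv v h \<in> borel_measurable borel"
    using cont by (rule borel_measurable_continuous_onI)
  have int_h: "integrable lborel h"
    using cont_h K by (rule integrable_of_compact_support)
  have zero: "dir_deriv v h x = 0" if "x \<notin> K" for x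
    using K that by (intro dir_deriv_eq_0_outside[of K]) (auto intro: compact_imp_closed)
  obtain B where B: "0 \<le> B" "\<And>x. \<bar>dir_deriv v h x\<bar> \<le> B"
    using bounded_of_compact_support[OF cont K(1) zero] by blast
  \<comment> \<open>The steps 1 / (n + 1) are at most 1, so every difference quotient vanishes away
    from the points within \<open>norm v\<close> of \<open>K\<close>. This one compact set supports
    the dominating function.\<close>
  define K' where "K' = (\<Union>x\<in>K. \<Union>y\<in>cball 0 (norm v). {x + y})"
  have K'_I: "x + y \<in> K'" if "x \<in> K" "norm y \<le> norm v" for x y
    unfolding K'_def using that by (intro UN_I[of x] UN_I[of y]) auto
  have K': "compact K'"
    unfolding K'_def using K(1) by (intro compact_sums') auto
  define s where "s = (\<lambda>n x. (h (x + (1 / real (Suc n)) *\<^sub>R v) - h x) / (1 / real (Suc n)))"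
  have [measurable]: "s n \<in> borel_measurable lborel" for n
    unfolding s_def by measurable
  have bound: "\<bar>s n x\<bar> \<le> B * indicator K' x" for n x
  proof (cases "x \<in> K'")
    case True
    define d where "d = 1 / real (Suc n)"
    have d: "0 < d" by (simp add: d_def)
    have "\<exists>z>0. z < d \<and> h (x + d *\<^sub>R v) - h (x + 0 *\<^sub>R v) = (d - 0) * dir_deriv v h (x + z *\<^sub>R v)"
      using d diff by (intro MVT2 DERIV_along_line)
    then obtain z where "h (x + d *\<^sub>R v) - h x = d * dir_deriv v h (x + z *\<^sub>R v)"
      by auto
    moreover have "s n x = (h (x + d *\<^sub>R v) - h x) / d"
      by (simp only: s_def d_def)
    ultimately have "s n x = dir_deriv v h (x + z *\<^sub>R v)"
      using d by simp
    then show ?thesis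
      using B True by simp
  next
    case False
    have "x \<notin> K" "x + (1 / real (Suc n)) *\<^sub>R v \<notin> K"
    proof -
      show "x \<notin> K"
        using False K'_I[of x 0] by auto
      show "x + (1 / real (Suc n)) *\<^sub>R v \<notin> K"
      proof
        assume "x + (1 / real (Suc n)) *\<^sub>R v \<in> K"
        moreover have "norm ((1 / real (Suc n)) *\<^sub>R v) \<le> norm v"
          by (simp add: divide_le_eq mult_le_cancel_left1)
        ultimately have "(x + (1 / real (Suc n)) *\<^sub>R v) + - ((1 / real (Suc n)) *\<^sub>R v) \<in> K'"
          by (intro K'_I) (simp_all only: norm_minus_cancel)
        then show False
          using False by simp
      qed
    qed
    then show ?thesis
      using K False by (simp add: s_def)
  qed
  have lim: "(\<lambda>n. s n x) \<longlonglongrightarrow> dir_deriv v h x" for x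
  proof -
    have "((\<lambda>t. h (x + t *\<^sub>R v)) has_real_derivative dir_deriv v h (x + 0 *\<^sub>R v)) (at 0)"
      by (intro DERIV_along_line diff)
    then have "((\<lambda>t. (h (x + t *\<^sub>R v) - h x) / t) \<longlongrightarrow> dir_deriv v h x) (at 0)"
      by (simp add: DERIV_def)
    moreover have "filterlim (\<lambda>n. 1 / real (Suc n)) (at 0) sequentially"
      using LIMSEQ_inverse_real_of_nat by (intro filterlim_atI) (auto simp: inverse_eq_divide)
    ultimately show ?thesis
      unfolding s_def by (rule filterlim_compose)
  qed
  have "(\<lambda>n. \<integral>x. s n x \<partial>lborel) \<longlonglongrightarrow> (\<integral>x. dir_deriv v h x \<partial>lborel)"
  proof (rule integral_dominated_convergence[where w = "\<lambda>x. B * indicator K' x"])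
    show "integrable lborel (\<lambda>x. B * indicator K' x)"
      using K' emeasure_bounded_finite[OF compact_imp_bounded[OF K']]
      by (intro integrable_mult_right integrable_real_indicator) (auto intro: borel_compact)
  qed (use bound lim in auto)
  moreover have "(\<integral>x. s n x \<partial>lborel) = 0" for n
  proof -
    have "integrable lborel (\<lambda>x. h (x + (1 / real (Suc n)) *\<^sub>R v))"
      using int_h integrable_distr[of "(+) ((1 / real (Suc n)) *\<^sub>R v)" lborel borel h]
      by (simp add: lborel_distr_plus add.commute)
    then show ?thesis
      using int_h unfolding s_def by (simp add: integral_lborel_translate)
  qed
  ultimately have "(\<lambda>n::nat. 0::real) \<longlonglongrightarrow> (\<integral>x. dir_deriv v h x \<partial>lborel)"
    by simp
  then show ?thesis
    using LIMSEQ_unique tendsto_const by blast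
qed

subsection \<open>The weak form of the operator\<close>

lemma axis_one_in_Basis [simp]: "axis i (1::real) \<in> Basis"
  by (simp add: axis_in_Basis_iff)

lemma grad_nth [simp]: "grad f x $ i = dir_deriv (axis i 1) f x"
  by (simp add: grad_def)

lemma sum_Basis_vec: "(\<Sum>e\<in>Basis. f e) = (\<Sum>i\<in>UNIV. f (axis i (1::real)))"
proof -
  have "bij_betw (\<lambda>i. axis i (1::real)) UNIV (Basis :: (real^'n) set)"
    by (auto simp: bij_betw_def inj_on_def axis_eq_axis Basis_vec_def)
  then show ?thesis
    by (rule sum.reindex_bij_betw[symmetric])
qed

lemma inner_axis_one [simp]: "x \<bullet> axis i (1::real) = x $ i"
  by (simp add: inner_axis)

section \<open>Product rules and supports for gradient and divergence\<close>

lemma grad_mult: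
  assumes "f differentiable (at x)" "g differentiable (at x)"
  shows "grad (\<lambda>x. f x * g x) x = f x *\<^sub>R grad g x + g x *\<^sub>R grad f x"
  using assms by (simp add: vec_eq_iff dir_deriv_mult)

lemma divergence_add:
  assumes "\<And>i. (\<lambda>y. F y $ i) differentiable (at x)" "\<And>i. (\<lambda>y. G y $ i) differentiable (at x)"
  shows "divergence (\<lambda>y. F y + G y) x = divergence F x + divergence G x"
  using assms by (simp add: divergence_def dir_deriv_add sum.distrib)

lemma divergence_scaleR:
  assumes "p differentiable (at x)" "\<And>i. (\<lambda>y. F y $ i) differentiable (at x)"
  shows "divergence (\<lambda>y. p y *\<^sub>R F y) x = p x * divergence F x + grad p x \<bullet> F x"
  using assms by (simp add: divergence_def dir_deriv_mult sum.distrib sum_distrib_left inner_vec_def)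

lemma divergence_minus:
  assumes "\<And>i. (\<lambda>y. F y $ i) differentiable (at x)"
  shows "divergence (\<lambda>y. - F y) x = - divergence F x"
  using divergence_scaleR[of "\<lambda>_. -1" x F] assms by (simp add: inner_vec_def)

lemma divergence_eq_0_outside:
  assumes "closed K" "\<And>x. x \<notin> K \<Longrightarrow> F x = 0" "x \<notin> K"
  shows "divergence F x = 0"
  unfolding divergence_def using assms by (intro sum.neutral ballI dir_deriv_eq_0_outside[of K]) auto

lemma grad_eq_0_outside:
  assumes "closed K" "\<And>x. x \<notin> K \<Longrightarrow> f x = 0" "x \<notin> K"
  shows "grad f x = 0"
  using dir_deriv_eq_0_outside[OF assms] by (simp add: vec_eq_iff)

lemma Ck_on_divergence:
  "(\<And>i. Ck_on (Suc k) UNIV (\<lambda>y. F y $ i)) \<Longrightarrow> Ck_on k UNIV (divergence F)"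
  unfolding divergence_def by (intro Ck_on_sum) simp

lemma integral_divergence_eq_0:
  fixes F :: "real^'n \<Rightarrow> real^'n"
  assumes F: "\<And>i. Ck_on (Suc 0) UNIV (\<lambda>y. F y $ i)" and K: "compact K" "\<And>x. x \<notin> K \<Longrightarrow> F x = 0"
  shows "(\<integral>x. divergence F x \<partial>lborel) = 0"
proof -
  have K': "closed K"
    using K(1) by (rule compact_imp_closed)
  have "dir_deriv (axis i 1) (\<lambda>y. F y $ i) x = 0" if "x \<notin> K" for x i
    using K(2) that by (intro dir_deriv_eq_0_outside[OF K']) auto
  then have "integrable lborel (dir_deriv (axis i 1) (\<lambda>y. F y $ i))" for i
    using F[of i] by (intro integrable_of_compact_support[OF _ K(1)]) auto
  then have "(\<integral>x. divergence F x \<partial>lborel) = (\<Sum>i\<in>UNIV. \<integral>x. dir_deriv (axis i 1) (\<lambda>y. F y $ i) x \<partial>lborel)"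
    unfolding divergence_def by (intro Bochner_Integration.integral_sum)
  also have "\<dots> = 0"
    using F K by (intro sum.neutral ballI integral_dir_deriv_eq_0[OF _ _ K(1)]) auto
  finally show ?thesis .
qed

lemma Ck_on_grad: "Ck_on (Suc k) UNIV f \<Longrightarrow> Ck_on k UNIV (\<lambda>x. grad f x $ i)"
  by simp

lemma Ck_on_inner_vec:
  fixes F G :: "'a::euclidean_space \<Rightarrow> real^'n"
  assumes "\<And>i. Ck_on k UNIV (\<lambda>x. F x $ i)" "\<And>i. Ck_on k UNIV (\<lambda>x. G x $ i)"
  shows "Ck_on k UNIV (\<lambda>x. F x \<bullet> G x)"
  using assms by (simp add: inner_vec_def Ck_on_sum Ck_on_mult)

section \<open>Integration by parts for the operator and its adjoint\<close>

locale smooth_coefficients =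
  fixes A :: "real^'n \<Rightarrow> real^'n^'n" and b :: "real^'n \<Rightarrow> real^'n"
  assumes A_smooth: "\<And>i j. smooth_on UNIV (\<lambda>x. A x $ i $ j)"
    and b_smooth: "\<And>j. smooth_on UNIV (\<lambda>x. b x $ j)"
    and A_sym: "\<And>x. transpose (A x) = A x"
begin

lemma A_inner_commute: "(A x *v \<xi>) \<bullet> \<eta> = (A x *v \<eta>) \<bullet> \<xi>"
  by (metis A_sym dot_lmul_matrix inner_commute transpose_matrix_vector)

lemma Ck_on_flux: "Ck_on (Suc k) UNIV w \<Longrightarrow> Ck_on k UNIV (\<lambda>y. (A y *v grad w y) $ i)"
  by (auto simp: matrix_vector_mult_def intro!: Ck_on_sum Ck_on_mult smooth_onD[OF A_smooth])

lemma Ck_on_diff_op: "Ck_on (Suc (Suc k)) UNIV w \<Longrightarrow> Ck_on k UNIV (diff_op A b w)"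
  unfolding diff_op_def
  by (intro Ck_on_add Ck_on_divergence Ck_on_flux Ck_on_inner_vec Ck_on_grad smooth_onD[OF b_smooth])
    (simp_all only: Ck_on_Suc_imp)

lemma Ck_on_scaled_drift: "Ck_on k UNIV w \<Longrightarrow> Ck_on k UNIV (\<lambda>y. (w y *\<^sub>R b y) $ i)"
  by (simp add: Ck_on_mult smooth_onD[OF b_smooth])

lemma Ck_on_diff_op_adjoint: "Ck_on (Suc (Suc k)) UNIV w \<Longrightarrow> Ck_on k UNIV (diff_op_adjoint A b w)"
  unfolding diff_op_adjoint_def
  by (intro Ck_on_diff Ck_on_divergence Ck_on_flux Ck_on_scaled_drift)
    (simp_all only: Ck_on_Suc_imp)

lemma diff_op_adjoint_eq_0_outside:
  assumes "closed K" "\<And>x. x \<notin> K \<Longrightarrow> \<phi> x = 0" "x \<notin> K"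
  shows "diff_op_adjoint A b \<phi> x = 0"
  unfolding diff_op_adjoint_def
  using assms grad_eq_0_outside[OF assms(1,2)]
  by (simp add: divergence_eq_0_outside[OF assms(1) _ assms(3)])

text \<open>One integration by parts, stopped at a form with only first derivatives of both factors.
  \<open>integral_mult_diff_op_adjoint\<close> reaches the same form from the other side, so
  chaining the two pairs \<open>L\<close> with its adjoint.\<close>

lemma integral_diff_op_mult:
  assumes w: "Ck_on 2 UNIV w" and \<phi>: "Ck_on (Suc 0) UNIV \<phi>"
    and K: "compact K" "\<And>x. x \<notin> K \<Longrightarrow> \<phi> x = 0"
  shows "(\<integral>x. diff_op A b w x * \<phi> x \<partial>lborel)
    = (\<integral>x. \<phi> x * (b x \<bullet> grad w x) - grad \<phi> x \<bullet> (A x *v grad w x) \<partial>lborel)"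
proof -
  have w2: "Ck_on (Suc (Suc 0)) UNIV w"
    using w by (simp only: numeral_2_eq_2)
  have w1: "Ck_on (Suc 0) UNIV w"
    using w2 by (rule Ck_on_Suc_imp)
  have K': "closed K"
    using K(1) by (rule compact_imp_closed)
  note flux = Ck_on_flux[OF w2]
  have d\<phi>: "\<phi> differentiable (at x)" and dflux: "(\<lambda>y. (A y *v grad w y) $ i) differentiable (at x)" for x i
    using \<phi> flux[of i] by auto
  define H where "H = (\<lambda>y. \<phi> y *\<^sub>R (A y *v grad w y))"
  have H: "Ck_on (Suc 0) UNIV (\<lambda>y. H y $ i)" for i
    unfolding H_def vector_scaleR_component real_scaleR_def by (intro Ck_on_mult \<phi> flux)
  have H0: "H x = 0" if "x \<notin> K" for x
    using K(2) that by (simp add: H_def)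
  let ?R = "\<lambda>x. \<phi> x * (b x \<bullet> grad w x) - grad \<phi> x \<bullet> (A x *v grad w x)"
  have eq: "diff_op A b w x * \<phi> x = divergence H x + ?R x" for x
    unfolding H_def diff_op_def by (simp add: divergence_scaleR[OF d\<phi> dflux] algebra_simps)
  have "Ck_on 0 UNIV ?R"
    using Ck_on_Suc_imp[OF \<phi>] Ck_on_Suc_imp[OF flux]
    by (intro Ck_on_diff Ck_on_mult Ck_on_inner_vec Ck_on_grad smooth_onD[OF b_smooth] \<phi> w1)
  then have "integrable lborel ?R"
    using K grad_eq_0_outside[OF K' K(2)] by (intro integrable_of_compact_support[OF _ K(1)]) auto
  moreover have "integrable lborel (divergence H)"
    using Ck_on_divergence[OF H] divergence_eq_0_outside[OF K' H0]
    by (intro integrable_of_compact_support[OF _ K(1)]) auto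
  ultimately show ?thesis
    unfolding eq using integral_divergence_eq_0[OF H K(1) H0] by simp
qed

text \<open>Asking only C^1 of \<open>w\<close> is the point: the identity then also applies to weak
  solutions that are not twice differentiable.\<close>

lemma integral_mult_diff_op_adjoint:
  assumes w: "Ck_on (Suc 0) UNIV w" and \<phi>: "Ck_on 2 UNIV \<phi>"
    and K: "compact K" "\<And>x. x \<notin> K \<Longrightarrow> \<phi> x = 0"
  shows "(\<integral>x. w x * diff_op_adjoint A b \<phi> x \<partial>lborel)
    = (\<integral>x. \<phi> x * (b x \<bullet> grad w x) - grad \<phi> x \<bullet> (A x *v grad w x) \<partial>lborel)"
proof -
  have \<phi>2: "Ck_on (Suc (Suc 0)) UNIV \<phi>"
    using \<phi> by (simp only: numeral_2_eq_2)
  have \<phi>1: "Ck_on (Suc 0) UNIV \<phi>"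
    using \<phi>2 by (rule Ck_on_Suc_imp)
  have K': "closed K"
    using K(1) by (rule compact_imp_closed)
  note flux = Ck_on_flux[OF \<phi>2] and drift = Ck_on_scaled_drift[OF \<phi>1]
  \<comment> \<open>The adjoint of \<phi> is the divergence of this field, so its product with
    \<open>w\<close> is div (w F) minus the inner product of grad w and F.\<close>
  define F where "F = (\<lambda>y. A y *v grad \<phi> y + - (\<phi> y *\<^sub>R b y))"
  have F: "Ck_on (Suc 0) UNIV (\<lambda>y. F y $ i)" for i
    unfolding F_def vector_add_component vector_uminus_component by (intro Ck_on_add Ck_on_minus flux drift)
  have dflux: "(\<lambda>y. (A y *v grad \<phi> y) $ i) differentiable (at x)" and ddrift: "(\<lambda>y. (\<phi> y *\<^sub>R b y) $ i) differentiable (at x)"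
    and dw: "w differentiable (at x)" and dF: "(\<lambda>y. F y $ i) differentiable (at x)" for x i
    using flux[of i] drift[of i] w F[of i] by (simp_all only: Ck_on.simps UNIV_I ball_simps)
  have div_F: "divergence F x = diff_op_adjoint A b \<phi> x" for x
  proof -
    have "(\<lambda>y. (- (\<phi> y *\<^sub>R b y)) $ i) differentiable (at x)" for i
      using ddrift[of i x] by (simp only: vector_uminus_component differentiable_minus)
    then show ?thesis
      unfolding F_def diff_op_adjoint_def
      by (simp only: divergence_add[OF dflux] divergence_minus[OF ddrift] diff_conv_add_uminus)
  qed
  define H where "H = (\<lambda>y. w y *\<^sub>R F y)"
  have H: "Ck_on (Suc 0) UNIV (\<lambda>y. H y $ i)" for i
    unfolding H_def vector_scaleR_component real_scaleR_def by (intro Ck_on_mult w F)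
  have F0: "F x = 0" if "x \<notin> K" for x
    using K(2) grad_eq_0_outside[OF K' K(2)] that by (simp add: F_def)
  have H0: "H x = 0" if "x \<notin> K" for x
    using F0 that by (simp add: H_def)
  let ?R = "\<lambda>x. \<phi> x * (b x \<bullet> grad w x) - grad \<phi> x \<bullet> (A x *v grad w x)"
  have R: "?R x = - (grad w x \<bullet> F x)" for x
    using A_inner_commute[of x "grad w x" "grad \<phi> x"] by (simp add: F_def inner_diff_right inner_commute)
  have eq: "w x * diff_op_adjoint A b \<phi> x = divergence H x + ?R x" for x
    unfolding H_def divergence_scaleR[OF dw dF] R div_F by simp
  have "Ck_on 0 UNIV (\<lambda>x. - (grad w x \<bullet> F x))"
    using Ck_on_Suc_imp[OF F] by (intro Ck_on_minus Ck_on_inner_vec Ck_on_grad w)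
  then have "integrable lborel ?R"
    unfolding R using F0 by (intro integrable_of_compact_support[OF _ K(1)]) auto
  moreover have "integrable lborel (divergence H)"
    using Ck_on_divergence[OF H] divergence_eq_0_outside[OF K' H0]
    by (intro integrable_of_compact_support[OF _ K(1)]) auto
  ultimately show ?thesis
    unfolding eq using integral_divergence_eq_0[OF H K(1) H0] by simp
qed

end

subsection \<open>Bump functions\<close>

text \<open>The family \<open>exp (-1/t) / t^n\<close> is closed under differentiation up to linear combinations.\<close>

definition flat_exp :: "nat \<Rightarrow> real \<Rightarrow> real"
  where "flat_exp n t = (if t \<le> 0 then 0 else exp (- 1 / t) / t ^ n)"

lemma flat_exp_tendsto_0: "(flat_exp n \<longlongrightarrow> 0) (at 0)"
proof -
  have "((\<lambda>t::real. inverse t ^ n / exp (inverse t)) \<longlongrightarrow> 0) (at_right 0)"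
    by (rule filterlim_compose[OF tendsto_power_div_exp_0 filterlim_inverse_at_top_right])
  moreover have "\<forall>\<^sub>F t in at_right 0. inverse t ^ n / exp (inverse t) = flat_exp n t"
    unfolding eventually_at_right_field
    by (intro exI[of _ 1]) (auto simp: flat_exp_def exp_minus field_simps)
  ultimately have "(flat_exp n \<longlongrightarrow> 0) (at_right 0)"
    by (rule Lim_transform_eventually)
  moreover have "(flat_exp n \<longlongrightarrow> 0) (at_left 0)"
    by (rule tendsto_eventually) (auto simp: eventually_at_left_field flat_exp_def intro!: exI[of _ "-1"])
  ultimately show ?thesis
    by (simp add: filterlim_at_split)
qed

lemma DERIV_flat_exp:
  "(flat_exp n has_real_derivative flat_exp (n + 2) t - real n * flat_exp (n + 1) t) (at t)"
proof -
  consider "t < 0" | "t = 0" | "0 < t" by linarith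
  then show ?thesis
  proof cases
    case 1
    have "((\<lambda>_. 0) has_real_derivative 0) (at t)" by simp
    then have "(flat_exp n has_real_derivative 0) (at t)"
      by (rule has_field_derivative_transform_within_open[where S = "{..<0}"]) (use 1 in \<open>auto simp: flat_exp_def\<close>)
    with 1 show ?thesis by (simp add: flat_exp_def)
  next
    case 2
    \<comment> \<open>At 0 the difference quotient of \<open>flat_exp n\<close> is
      \<open>flat_exp (n + 1)\<close>, so the limit lemma one index higher is the
      derivative.\<close>
    have "flat_exp (n + 1) = (\<lambda>h. flat_exp n h / h)"
      by (intro ext) (simp add: flat_exp_def field_simps)
    with flat_exp_tendsto_0[of "n + 1"] have "((\<lambda>h. (flat_exp n (0 + h) - flat_exp n 0) / h) \<longlongrightarrow> 0) (at 0)"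
      by (simp add: flat_exp_def[of _ 0])
    with 2 show ?thesis by (simp add: DERIV_def flat_exp_def[of _ 0])
  next
    case 3
    have "((\<lambda>t. exp (- 1 / t) / t ^ n) has_real_derivative
        (exp (- 1 / t) / t ^ (n + 2) - real n * (exp (- 1 / t) / t ^ (n + 1)))) (at t)"
    proof -
      have "((\<lambda>t. exp (- 1 / t) / t ^ n) has_real_derivative
          ((exp (- 1 / t) * (1 / (t * t))) * t ^ n - exp (- 1 / t) * (real n * t ^ (n - 1))) / (t ^ n * t ^ n)) (at t)"
        using 3 by (auto intro!: derivative_eq_intros simp: field_simps)
      \<comment> \<open>For n = 0 the truncated exponent n - 1 is harmless because the factor n
        vanishes; hence the case split.\<close>
      moreover have "((exp (- 1 / t) * (1 / (t * t))) * t ^ n - exp (- 1 / t) * (real n * t ^ (n - 1))) / (t ^ n * t ^ n)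
          = exp (- 1 / t) / t ^ (n + 2) - real n * (exp (- 1 / t) / t ^ (n + 1))"
        using 3 by (cases n) (simp_all add: field_simps)
      ultimately show ?thesis by simp
    qed
    then have "(flat_exp n has_real_derivative
        (exp (- 1 / t) / t ^ (n + 2) - real n * (exp (- 1 / t) / t ^ (n + 1)))) (at t)"
      by (rule has_field_derivative_transform_within_open[where S = "{0<..}"]) (use 3 in \<open>auto simp: flat_exp_def\<close>)
    with 3 show ?thesis by (simp add: flat_exp_def)
  qed
qed

text \<open>A derivative of the composition is a partial of \<open>q\<close> times a combination of
  \<open>flat_exp (n + 2)\<close> and \<open>flat_exp (n + 1)\<close> at \<open>q\<close>, so
  generalizing over n closes the induction on the order.\<close>

lemma Ck_on_flat_exp:
  assumes "\<And>k. Ck_on k UNIV q"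
  shows "Ck_on k UNIV (\<lambda>x. flat_exp n (q x))"
proof (induction k arbitrary: n)
  case 0
  have "continuous_on UNIV (flat_exp n)"
    by (rule DERIV_continuous_on[OF has_field_derivative_at_within[OF DERIV_flat_exp]])
  then show ?case
    using assms[of 0] by (auto intro: continuous_on_compose2)
next
  case (Suc k)
  have d: "((\<lambda>x. flat_exp n (q x)) has_derivative
      (\<lambda>v. dir_deriv v q x * (flat_exp (n + 2) (q x) - real n * flat_exp (n + 1) (q x)))) (at x)" for x
  proof -
    have "(q has_derivative (\<lambda>v. dir_deriv v q x)) (at x)"
      using assms[of "Suc 0"] by (intro has_derivative_dir_deriv) auto
    then show ?thesis
      by (rule DERIV_compose_FDERIV[OF DERIV_flat_exp])
  qed
  have eq: "dir_deriv v (\<lambda>x. flat_exp n (q x)) =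
      (\<lambda>x. dir_deriv v q x * (flat_exp (n + 2) (q x) - real n * flat_exp (n + 1) (q x)))" for v
    by (intro ext dir_deriv_eqI[OF d])
  have "Ck_on k UNIV (dir_deriv v (\<lambda>x. flat_exp n (q x)))" if "v \<in> Basis" for v
    unfolding eq using that assms[of "Suc k"] by (intro Ck_on_mult Ck_on_diff Ck_on_const Suc.IH) auto
  then show ?case
    using d by (auto simp: differentiable_def)
qed

lemma exists_bump:
  fixes a :: "'a::euclidean_space"
  assumes "0 < r"
  obtains \<phi> :: "'a \<Rightarrow> real" where "test_function UNIV \<phi>" "\<And>x. 0 \<le> \<phi> x" "\<And>x. \<phi> x \<noteq> 0 \<longleftrightarrow> dist a x < r"
proof
  \<comment> \<open>This is r^2 - |x - a|^2, positive exactly inside the ball; the coordinate sum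
    exhibits it as a polynomial.\<close>
  define q where "q = (\<lambda>x. r\<^sup>2 - (\<Sum>e\<in>Basis. ((x - a) \<bullet> e) * ((x - a) \<bullet> e)))"
  have q: "q x = r\<^sup>2 - (dist a x)\<^sup>2" for x
    unfolding q_def euclidean_inner[symmetric] dist_norm norm_minus_commute[of a] power2_norm_eq_inner ..
  have "Ck_on k UNIV (\<lambda>x. (x - a) \<bullet> e)" for k and e :: 'a
    using Ck_on_add[OF Ck_on_inner_const[OF Ck_on_bounded_linear[OF bounded_linear_ident]] Ck_on_const, of k e "- (a \<bullet> e)"]
    by (simp add: inner_diff_left)
  then have Ck: "Ck_on k UNIV q" for k
    unfolding q_def by (intro Ck_on_diff Ck_on_const Ck_on_sum Ck_on_mult)
  show supp: "flat_exp 0 (q x) \<noteq> 0 \<longleftrightarrow> dist a x < r" for x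
    using abs_le_square_iff[of r "dist a x"] assms by (simp add: flat_exp_def q not_le)
  have "closure (support_on UNIV (\<lambda>x. flat_exp 0 (q x))) \<subseteq> cball a r"
    by (intro closure_minimal) (auto simp: support_on_def supp)
  then show "test_function UNIV (\<lambda>x. flat_exp 0 (q x))"
    unfolding test_function_def smooth_on_def
    using Ck_on_flat_exp[OF Ck] bounded_subset[OF bounded_cball, of "closure (support_on UNIV (\<lambda>x. flat_exp 0 (q x)))" a r]
    by (simp add: compact_eq_bounded_closed)
  show "0 \<le> flat_exp 0 (q x)" for x
    by (simp add: flat_exp_def)
qed

lemma test_functionE:
  assumes "test_function \<Omega> \<phi>"
  obtains K where "compact K" "K \<subseteq> \<Omega>" "\<And>x. x \<notin> K \<Longrightarrow> \<phi> x = 0"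
proof
  show "compact (closure (support_on UNIV \<phi>))" "closure (support_on UNIV \<phi>) \<subseteq> \<Omega>"
    using assms by (auto simp: test_function_def)
  show "\<phi> x = 0" if "x \<notin> closure (support_on UNIV \<phi>)" for x
    using that closure_subset[of "support_on UNIV \<phi>"] by (auto simp: support_on_def)
qed

lemma test_function_Ck: "test_function \<Omega> \<phi> \<Longrightarrow> Ck_on k UNIV \<phi>"
  by (auto simp: test_function_def smooth_on_def)

section \<open>Continuous functions that vanish almost everywhere or against all test
  functions\<close>

lemma open_AE_lborel_empty:
  fixes U :: "'a::euclidean_space set"
  assumes "open U" "AE x in lborel. x \<notin> U"
  shows "U = {}"
proof -
  have "U \<in> null_sets lborel"
    using assms by (subst AE_iff_null_sets) auto
  then have "negligible U"
    by (simp add: negligible_iff_null_sets null_sets_completionI)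
  then show ?thesis
    using assms(1) open_not_negligible by blast
qed

lemma continuous_nonneg_integral_eq_0:
  fixes f :: "'a::euclidean_space \<Rightarrow> real"
  assumes "continuous_on UNIV f" "integrable lborel f" "\<And>x. 0 \<le> f x" "(\<integral>x. f x \<partial>lborel) = 0"
  shows "f x = 0"
proof -
  have "AE x in lborel. f x = 0"
    using assms by (subst (asm) integral_nonneg_eq_0_iff_AE) auto
  moreover have "open {x. f x \<noteq> 0}"
    using assms(1) by (intro open_Collect_neq) (auto intro: continuous_on_const)
  ultimately have "{x. f x \<noteq> 0} = {}"
    by (intro open_AE_lborel_empty) auto
  then show ?thesis by blast
qed

text \<open>The fundamental lemma of the calculus of variations: near a point where \<open>f\<close>
  is nonzero it keeps its sign, so a bump living there would have nonzero integral against
  it.\<close>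

lemma continuous_eq_0_of_test_functions:
  fixes f :: "'a::euclidean_space \<Rightarrow> real"
  assumes cont: "continuous_on UNIV f"
    and test: "\<And>\<phi>. test_function UNIV \<phi> \<Longrightarrow> (\<integral>x. f x * \<phi> x \<partial>lborel) = 0"
  shows "f a = 0"
proof (rule ccontr)
  assume "f a \<noteq> 0"
  then obtain r where r: "0 < r" "\<And>x. dist x a < r \<Longrightarrow> dist (f x) (f a) < \<bar>f a\<bar>"
    using cont[unfolded continuous_on_iff, rule_format, of a "\<bar>f a\<bar>"] by (auto simp only: UNIV_I zero_less_abs_iff)
  obtain \<phi> :: "'a \<Rightarrow> real" where \<phi>: "test_function UNIV \<phi>" "\<And>x. 0 \<le> \<phi> x" "\<And>x. \<phi> x \<noteq> 0 \<longleftrightarrow> dist a x < r"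
    by (rule exists_bump[OF r(1), of a]) (rule that)
  obtain K where K: "compact K" "\<And>x. x \<notin> K \<Longrightarrow> \<phi> x = 0"
    by (rule test_functionE[OF \<phi>(1)]) auto
  define c where "c = sgn (f a)"
  have c: "c \<noteq> 0"
    using \<open>f a \<noteq> 0\<close> by (simp add: c_def sgn_zero_iff)
  define g where "g = (\<lambda>x. c * (f x * \<phi> x))"
  have cg: "continuous_on UNIV g"
    unfolding g_def using test_function_Ck[OF \<phi>(1), of 0]
    by (intro continuous_on_mult continuous_on_const cont) simp
  have "g a = 0"
  proof (rule continuous_nonneg_integral_eq_0[OF cg])
    show "integrable lborel g"
      by (rule integrable_of_compact_support[OF cg K(1)]) (simp add: g_def K(2))
    show "(\<integral>x. g x \<partial>lborel) = 0"
      unfolding g_def by (simp add: test[OF \<phi>(1)])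
    show "0 \<le> g x" for x
    proof (cases "dist a x < r")
      case True
      then have "\<bar>f x - f a\<bar> < \<bar>f a\<bar>"
        using r(2)[of x] by (simp add: dist_commute dist_real_def)
      then have "0 \<le> c * f x"
        unfolding c_def by (cases "0 \<le> f a"; cases "f a = 0"; simp)
      then have "0 \<le> (c * f x) * \<phi> x"
        using \<phi>(2)[of x] by (rule mult_nonneg_nonneg)
      then show ?thesis
        by (simp only: mult.assoc g_def)
    next
      case False
      then have "\<phi> x = 0"
        using \<phi>(3)[of x] by blast
      then show ?thesis
        by (simp add: g_def)
    qed
  qed
  moreover have "\<phi> a \<noteq> 0"
    using \<phi>(3)[of a] r(1) by simp
  ultimately show False
    using \<open>f a \<noteq> 0\<close> c by (simp add: g_def)
qed

subsection \<open>Left invariance for functions of class \<open>C^2\<close>\<close>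

abbreviation pd :: "'n \<Rightarrow> (real^'n \<Rightarrow> 'b::real_normed_vector) \<Rightarrow> real^'n \<Rightarrow> 'b"
  where "pd i \<equiv> dir_deriv (axis i 1)"

text \<open>
  Symmetrizing the second derivatives avoids Schwarz's theorem: since \<open>A\<close> is symmetric, the operator
  only sees this combination.
\<close>
definition sym_pd2 :: "'n \<Rightarrow> 'n \<Rightarrow> (real^'n \<Rightarrow> real) \<Rightarrow> real^'n \<Rightarrow> real"
  where "sym_pd2 i j f x = pd i (pd j f) x + pd j (pd i f) x"

lemma Ck_on_2_pd:
  assumes "Ck_on 2 UNIV f"
  shows "f differentiable (at x)" "Ck_on (Suc 0) UNIV (pd i f)" "pd i f differentiable (at x)"
proof -
  show "f differentiable (at x)"
    using assms by (rule Ck_on_imp_differentiable) simp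
  show *: "Ck_on (Suc 0) UNIV (pd i f)"
    using assms axis_one_in_Basis unfolding numeral_2_eq_2 Ck_on.simps(2)[of "Suc 0"] by blast
  show "pd i f differentiable (at x)"
    using * by (rule Ck_on_imp_differentiable) simp
qed

context smooth_coefficients
begin

lemma A_nth_commute: "A x $ i $ j = A x $ j $ i"
  using arg_cong[OF A_sym[of x], of "\<lambda>M. M $ j $ i"] by (simp add: transpose_def)

text \<open>The nondivergence form. Symmetry of \<open>A\<close> makes both orders of the mixed
  partials contribute the same sum, so passing to \<open>sym_pd2\<close> costs a factor 1/2.\<close>

lemma diff_op_eq:
  assumes w: "Ck_on 2 UNIV w"
  shows "diff_op A b w x = (\<Sum>i\<in>UNIV. \<Sum>j\<in>UNIV. pd i (\<lambda>y. A y $ i $ j) x * pd j w x)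
    + (\<Sum>i\<in>UNIV. \<Sum>j\<in>UNIV. A x $ i $ j * sym_pd2 i j w x) / 2 + (\<Sum>i\<in>UNIV. b x $ i * pd i w x)"
proof -
  have dA: "(\<lambda>y. A y $ i $ j) differentiable (at x)" for i j
    by (rule Ck_on_imp_differentiable[OF smooth_onD[OF A_smooth, where k = "Suc 0"]]) simp
  have "pd i (\<lambda>y. (A y *v grad w y) $ i) x
      = (\<Sum>j\<in>UNIV. A x $ i $ j * pd i (pd j w) x + pd i (\<lambda>y. A y $ i $ j) x * pd j w x)" for i
    using dA Ck_on_2_pd[OF w] by (simp add: matrix_vector_mult_def dir_deriv_sum dir_deriv_mult)
  then have "diff_op A b w x = (\<Sum>i\<in>UNIV. \<Sum>j\<in>UNIV. pd i (\<lambda>y. A y $ i $ j) x * pd j w x)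
    + (\<Sum>i\<in>UNIV. \<Sum>j\<in>UNIV. A x $ i $ j * pd i (pd j w) x) + (\<Sum>i\<in>UNIV. b x $ i * pd i w x)"
    by (simp add: diff_op_def divergence_def sum.distrib inner_vec_def)
  moreover have "(\<Sum>i\<in>UNIV. \<Sum>j\<in>UNIV. A x $ i $ j * pd j (pd i w) x)
      = (\<Sum>i\<in>UNIV. \<Sum>j\<in>UNIV. A x $ i $ j * pd i (pd j w) x)"
    by (subst sum.swap) (simp add: A_nth_commute[of x])
  ultimately show ?thesis
    by (simp add: sym_pd2_def distrib_left sum.distrib)
qed

lemma diff_op_cong_jet:
  assumes "Ck_on 2 UNIV f" "Ck_on 2 UNIV h"
    and "\<And>i. pd i f x = pd i h x" "\<And>i j. sym_pd2 i j f x = sym_pd2 i j h x"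
  shows "diff_op A b f x = diff_op A b h x"
  using assms by (simp add: diff_op_eq)

end

lemma pd_compose:
  fixes g :: "real^'n \<Rightarrow> real^'n"
  assumes "f differentiable (at (g x))" "g differentiable (at x)"
  shows "pd i (\<lambda>x. f (g x)) x = (\<Sum>k\<in>UNIV. pd i g x $ k * pd k f (g x))"
  using dir_deriv_compose[OF assms, of "axis i 1"] by (simp add: sum_Basis_vec)

text \<open>What matters is that \<open>f\<close> enters only through its first and symmetrized
  second derivatives at \<open>g x\<close>: two functions sharing these data still share them after
  composition with \<open>g\<close>.\<close>

lemma sym_pd2_compose:
  fixes g :: "real^'n \<Rightarrow> real^'n"
  assumes f: "Ck_on 2 UNIV f" and g: "Ck_on 2 UNIV g"
  shows "sym_pd2 i j (\<lambda>x. f (g x)) x =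
    (\<Sum>k\<in>UNIV. \<Sum>l\<in>UNIV. pd i g x $ k * pd j g x $ l * sym_pd2 l k f (g x))
    + (\<Sum>k\<in>UNIV. sym_pd2 i j (\<lambda>x. g x $ k) x * pd k f (g x))"
proof -
  have dg: "g differentiable (at x)" for x
    using g by (rule Ck_on_imp_differentiable) simp
  have "pd i (\<lambda>x. g x $ k) = (\<lambda>x. pd i g x $ k)" for i k
    using dg by (intro ext dir_deriv_compose_bounded_linear bounded_linear_vec_nth)
  then have dgk: "(\<lambda>x. pd i g x $ k) differentiable (at x)" and pgk: "(\<lambda>x. pd i g x $ k) = pd i (\<lambda>x. g x $ k)" for i k x
    using Ck_on_2_pd(3)[OF Ck_on_vec_nth[OF g]] by (metis, metis)
  have dfg: "(\<lambda>x. pd k f (g x)) differentiable (at x)" for k x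
    by (intro differentiable_compose[of "pd k f" g] Ck_on_2_pd(3)[OF f] dg)
  have 1: "pd i (\<lambda>x. f (g x)) = (\<lambda>x. \<Sum>k\<in>UNIV. pd i g x $ k * pd k f (g x))" for i
    by (intro ext pd_compose[where f = f and g = g] Ck_on_2_pd(1)[OF f] dg)
  have 2: "pd j (pd i (\<lambda>x. f (g x))) x = (\<Sum>k\<in>UNIV. \<Sum>l\<in>UNIV. pd i g x $ k * pd j g x $ l * pd l (pd k f) (g x))
      + (\<Sum>k\<in>UNIV. pd j (pd i (\<lambda>x. g x $ k)) x * pd k f (g x))" for i j
  proof -
    have "pd j (\<lambda>x. pd k f (g x)) x = (\<Sum>l\<in>UNIV. pd j g x $ l * pd l (pd k f) (g x))" for k
      by (intro pd_compose[where f = "pd k f" and g = g] Ck_on_2_pd(3)[OF f] dg)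
    moreover have "pd j (\<lambda>x. \<Sum>k\<in>UNIV. pd i g x $ k * pd k f (g x)) x
        = (\<Sum>k\<in>UNIV. pd j (\<lambda>x. pd i g x $ k * pd k f (g x)) x)"
      by (intro dir_deriv_sum differentiable_mult dgk dfg)
    moreover have "pd j (\<lambda>x. pd i g x $ k * pd k f (g x)) x
        = pd i g x $ k * pd j (\<lambda>x. pd k f (g x)) x + pd j (\<lambda>x. pd i g x $ k) x * pd k f (g x)" for k
      by (rule dir_deriv_mult[OF dgk dfg])
    ultimately show ?thesis
      unfolding 1 by (simp only: pgk sum.distrib sum_distrib_left mult.assoc)
  qed
  \<comment> \<open>Exchanging \<open>i\<close> and \<open>j\<close> is undone by renaming the
    summation indices, at the price of swapping the two derivatives of \<open>f\<close>; this
    produces the symmetrized form.\<close>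
  have "(\<Sum>k\<in>UNIV. \<Sum>l\<in>UNIV. pd j g x $ k * pd i g x $ l * pd l (pd k f) (g x))
     = (\<Sum>k\<in>UNIV. \<Sum>l\<in>UNIV. pd i g x $ k * pd j g x $ l * pd k (pd l f) (g x))"
    by (subst sum.swap) (simp add: mult.commute)
  then show ?thesis
    unfolding sym_pd2_def[of i j] 2
    by (simp add: sym_pd2_def distrib_left distrib_right sum.distrib)
qed

lemma exists_smooth_jet:
  fixes G :: "'n::finite \<Rightarrow> real" and S :: "'n \<Rightarrow> 'n \<Rightarrow> real" and z :: "real^'n"
  assumes S: "\<And>i j. S i j = S j i"
  obtains p where "smooth_on UNIV p" "\<And>i. pd i p z = G i" "\<And>i j. sym_pd2 i j p z = S i j"
proof
  define y where "y = (\<lambda>k (x::real^'n). x $ k - z $ k)"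
  have Ck_y: "Ck_on m UNIV (y k)" for m k
    unfolding y_def by (intro Ck_on_diff Ck_on_const Ck_on_vec_nth Ck_on_bounded_linear bounded_linear_ident)
  have dy: "y k differentiable (at x)" for k x
    using Ck_y[of "Suc 0"] by (rule Ck_on_imp_differentiable) simp
  have pd_y: "pd i (y k) x = (if i = k then 1 else 0)" for i k x
  proof -
    have "(y k has_derivative (\<lambda>v. v $ k)) (at x)"
      unfolding y_def by (auto intro!: derivative_eq_intros bounded_linear_imp_has_derivative bounded_linear_vec_nth)
    from dir_deriv_eqI[OF this, of "axis i 1"] show ?thesis
      by (auto simp: axis_def)
  qed
  \<comment> \<open>\<open>p\<close> will be a quadratic polynomial. Differentiating its symmetric
    quadratic part twice gives 2 Q, and \<open>sym_pd2\<close> adds the two orders, so Q must be S /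
    4.\<close>
  define Q where "Q = (\<lambda>k l. S k l / 4)"
  have Q_sym: "Q i j = Q j i" for i j
    using S[of i j] by (simp add: Q_def)
  define p where "p = (\<lambda>x. \<Sum>k\<in>UNIV. y k x * (G k + (\<Sum>l\<in>UNIV. Q k l * y l x)))"
  show smooth: "smooth_on UNIV p"
    unfolding smooth_on_def p_def by (intro allI Ck_on_sum Ck_on_mult Ck_on_add Ck_on_const Ck_y)
  have d_inner: "(\<lambda>x. \<Sum>l\<in>UNIV. c l * y l x) differentiable (at x)" for c x
    using dy by (intro differentiable_sum differentiable_mult) auto
  have pd_inner: "pd i (\<lambda>x. \<Sum>l\<in>UNIV. c l * y l x) x = c i" for c i x
    using dy by (simp add: dir_deriv_sum dir_deriv_mult differentiable_mult pd_y mult_delta_right)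
  have pd_p: "pd i p = (\<lambda>x. G i + (\<Sum>l\<in>UNIV. (2 * Q i l) * y l x))" for i
  proof
    fix x
    have "pd i p x = (\<Sum>k\<in>UNIV. y k x * Q k i + (if i = k then 1 else 0) * (G k + (\<Sum>l\<in>UNIV. Q k l * y l x)))"
      unfolding p_def using dy d_inner
      by (simp add: dir_deriv_sum dir_deriv_mult dir_deriv_add differentiable_mult differentiable_add pd_y pd_inner)
    also have "\<dots> = (\<Sum>k\<in>UNIV. Q i k * y k x) + (G i + (\<Sum>l\<in>UNIV. Q i l * y l x))"
      by (simp add: sum.distrib mult_delta_left Q_sym[of _ i] mult.commute[of "y _ _"])
    also have "\<dots> = G i + (\<Sum>l\<in>UNIV. (2 * Q i l) * y l x)"
      by (simp add: sum_distrib_left mult.assoc)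
    finally show "pd i p x = G i + (\<Sum>l\<in>UNIV. (2 * Q i l) * y l x)" .
  qed
  show "pd i p z = G i" for i
    by (simp add: pd_p y_def)
  have pd2_p: "pd j (pd i p) z = 2 * Q i j" for i j
  proof -
    have "pd j (pd i p) z = pd j (\<lambda>_. G i) z + pd j (\<lambda>x. \<Sum>l\<in>UNIV. (2 * Q i l) * y l x) z"
      unfolding pd_p by (intro dir_deriv_add d_inner differentiable_const)
    then show ?thesis
      by (simp only: pd_inner dir_deriv_const add_0)
  qed
  show "sym_pd2 i j p z = S i j" for i j
    unfolding sym_pd2_def pd2_p using S[of i j] by (simp add: Q_def)
qed

text \<open>The invariance hypothesis covers smooth functions only. \<open>w\<close> is traded for a
  smooth function with the same derivatives at \<open>mul \<alpha> x\<close>, the hypothesis is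
  applied to that, and the trade is reversed; no approximation is involved.\<close>

lemma (in smooth_coefficients) diff_op_translate:
  assumes inv: "left_translation_invariant mul (diff_op A b)"
    and g: "Ck_on 2 UNIV (mul \<alpha>)" and w: "Ck_on 2 UNIV w"
  shows "diff_op A b (\<lambda>y. w (mul \<alpha> y)) x = diff_op A b w (mul \<alpha> x)"
proof -
  obtain p where p: "smooth_on UNIV p" "\<And>i. pd i p (mul \<alpha> x) = pd i w (mul \<alpha> x)"
      "\<And>i j. sym_pd2 i j p (mul \<alpha> x) = sym_pd2 i j w (mul \<alpha> x)"
  proof (rule exists_smooth_jet[where S = "\<lambda>i j. sym_pd2 i j w (mul \<alpha> x)" and z = "mul \<alpha> x"
        and G = "\<lambda>i. pd i w (mul \<alpha> x)"])
    show "sym_pd2 i j w (mul \<alpha> x) = sym_pd2 j i w (mul \<alpha> x)" for i j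
      by (simp only: sym_pd2_def add.commute)
  qed (rule that)
  note p2 = smooth_onD[OF p(1), of 2]
  have dg: "mul \<alpha> differentiable (at x)" for x
    using g by (rule Ck_on_imp_differentiable) simp
  have "diff_op A b (\<lambda>y. w (mul \<alpha> y)) x = diff_op A b (\<lambda>y. p (mul \<alpha> y)) x"
  proof (rule diff_op_cong_jet)
    show "pd i (\<lambda>y. w (mul \<alpha> y)) x = pd i (\<lambda>y. p (mul \<alpha> y)) x" for i
      using pd_compose[where f = w and g = "mul \<alpha>", OF Ck_on_2_pd(1)[OF w] dg]
        pd_compose[where f = p and g = "mul \<alpha>", OF Ck_on_2_pd(1)[OF p2] dg] by (simp only: p)
    show "sym_pd2 i j (\<lambda>y. w (mul \<alpha> y)) x = sym_pd2 i j (\<lambda>y. p (mul \<alpha> y)) x" for i j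
      by (simp only: sym_pd2_compose[OF w g] sym_pd2_compose[OF p2 g] p)
  qed (rule Ck_on_compose[OF w g] Ck_on_compose[OF p2 g])+
  also have "\<dots> = diff_op A b p (mul \<alpha> x)"
    using inv p(1) unfolding left_translation_invariant_def by blast
  also have "\<dots> = diff_op A b w (mul \<alpha> x)"
    by (rule diff_op_cong_jet[OF p2 w]) (simp_all add: p)
  finally show ?thesis .
qed

subsection \<open>Nonnegative \<open>L v\<close> for integrable \<open>v\<close>\<close>

text \<open>Invariance is stated for images of sets, a push-forward for preimages; surjectivity
  identifies the image of the preimage of \<open>E\<close> with \<open>E\<close>.\<close>

lemma distr_right_translation:
  fixes mul :: "'a::euclidean_space \<Rightarrow> 'a \<Rightarrow> 'a"
  assumes haar: "right_invariant_measure mul lebesgue"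
    and meas: "(\<lambda>x. mul x a) \<in> borel_measurable borel" and surj: "surj (\<lambda>x. mul x a)"
  shows "distr lborel borel (\<lambda>x. mul x a) = lborel"
proof (rule measure_eqI)
  fix E assume "E \<in> sets (distr lborel borel (\<lambda>x. mul x a))"
  then have E: "E \<in> sets borel" by simp
  let ?B = "(\<lambda>x. mul x a) -` E"
  have B: "?B \<in> sets borel"
    using measurable_sets[OF meas E] by simp
  have "(\<lambda>x. mul x a) ` ?B = E"
    using surj by (rule surj_image_vimage_eq)
  moreover have "emeasure lebesgue ((\<lambda>x. mul x a) ` ?B) = emeasure lebesgue ?B"
  proof -
    have "?B \<in> sets lebesgue"
      using B by simp
    then show ?thesis
      using haar unfolding right_invariant_measure_def by blast
  qed
  ultimately have "emeasure lebesgue E = emeasure lebesgue ?B"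
    by simp
  then show "emeasure (distr lborel borel (\<lambda>x. mul x a)) E = emeasure lborel E"
    using E B meas by (simp add: emeasure_distr)
qed simp

lemma diff_op_1:
  fixes A :: "real^'n \<Rightarrow> real^'n^'n"
  shows "diff_op A b (\<lambda>_. 1) x = 0"
proof -
  have "grad (\<lambda>_. 1) y = 0" for y :: "real^'n"
    by (simp add: vec_eq_iff)
  then show ?thesis
    by (simp add: diff_op_def divergence_def)
qed

text \<open>
  Testing \<open>L v\<close> against a bump \<open>\<psi>\<close> carried around by left translations and integrating over all
  translations, Fubini's theorem and right invariance give the total mass of \<open>v\<close> times the
  integral of \<open>L\<^sup>* \<psi>\<close>, which vanishes because \<open>L 1 = 0\<close>.
\<close>
lemma (in smooth_coefficients) diff_op_eq_0_of_nonneg: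
  assumes grp: "group mul e iv" and mul_smooth: "smooth_on UNIV (\<lambda>(x, y). mul x y)"
    and inv: "left_translation_invariant mul (diff_op A b)"
    and haar: "right_invariant_measure mul lebesgue"
    and v: "Ck_on 2 UNIV v" and int_v: "integrable lborel v"
    and nonneg: "\<And>x. 0 \<le> diff_op A b v x"
  shows "diff_op A b v z = 0"
proof -
  interpret group mul e iv by (rule grp)
  have Ck_mul: "Ck_on k UNIV (mul \<alpha>)" for k \<alpha>
    using Ck_on_fix_left[OF smooth_onD[OF mul_smooth], of k \<alpha>] by simp
  have cont_mul: "continuous_on UNIV (\<lambda>p. mul (fst p) (snd p))"
    using smooth_onD[OF mul_smooth, of 0] by (simp add: case_prod_unfold)
  have cont_right: "continuous_on UNIV (\<lambda>x. mul x a)" for a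
    using continuous_on_compose2[OF cont_mul, of UNIV "\<lambda>x. (x, a)"]
    by (simp add: continuous_on_Pair continuous_on_const)
  have right_cancel: "mul (mul x (iv a)) a = x" for x a
    by (simp add: assoc)
  have surj: "surj (\<lambda>x. mul x a)" for a
    by (rule surjI[of _ "\<lambda>x. mul x (iv a)"]) (rule right_cancel)
  have distr: "distr lborel borel (\<lambda>x. mul x a) = lborel" for a
    using cont_right surj by (intro distr_right_translation[OF haar] borel_measurable_continuous_onI)
  have cont_v: "continuous_on UNIV v"
    using v by (rule Ck_on_imp_continuous)
  have meas_right [measurable]: "(\<lambda>x. mul x a) \<in> borel_measurable lborel" for a
    using borel_measurable_continuous_onI[OF cont_right] by simp
  have meas_v [measurable]: "v \<in> borel_measurable borel"
    using cont_v by (rule borel_measurable_continuous_onI)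
  have int_right: "integrable lborel (\<lambda>x. v (mul x a))" for a
    using int_v integrable_distr_eq[OF meas_right meas_v, of a] by (simp add: distr)
  have integral_right: "(\<integral>x. v (mul x a) \<partial>lborel) = (\<integral>x. v x \<partial>lborel)"
    and integral_right_abs: "(\<integral>x. \<bar>v (mul x a)\<bar> \<partial>lborel) = (\<integral>x. \<bar>v x\<bar> \<partial>lborel)" for a
    using integral_distr[OF meas_right meas_v, of a] integral_distr[OF meas_right, of "\<lambda>x. \<bar>v x\<bar>" a]
    by (simp_all add: distr)

  obtain \<psi> :: "real^'n \<Rightarrow> real" where \<psi>: "test_function UNIV \<psi>" "\<And>x. 0 \<le> \<psi> x" "\<And>x. \<psi> x \<noteq> 0 \<longleftrightarrow> dist 0 x < 1"
    by (rule exists_bump[OF zero_less_one, of 0]) (rule that)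
  obtain K where K: "compact K" "\<And>x. x \<notin> K \<Longrightarrow> \<psi> x = 0"
    by (rule test_functionE[OF \<psi>(1)]) auto
  note Ck_\<psi> = test_function_Ck[OF \<psi>(1)]
  define c where "c = diff_op_adjoint A b \<psi>"
  have cont_c: "continuous_on UNIV c"
    using Ck_on_diff_op_adjoint[OF Ck_\<psi>, of 0] by (simp add: c_def)
  have c0: "c x = 0" if "x \<notin> K" for x
    unfolding c_def by (rule diff_op_adjoint_eq_0_outside[OF compact_imp_closed[OF K(1)] K(2) that])
  have int_c: "integrable lborel c"
    by (rule integrable_of_compact_support[OF cont_c K(1) c0])
  have Lw: "(\<integral>x. diff_op A b w x * \<psi> x \<partial>lborel) = (\<integral>x. w x * c x \<partial>lborel)" if "Ck_on 2 UNIV w" for w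
    unfolding c_def
    by (rule trans[OF integral_diff_op_mult[OF that Ck_\<psi> K]
          integral_mult_diff_op_adjoint[OF Ck_on_mono[OF that] Ck_\<psi> K, symmetric]]) simp_all
  have integral_c: "(\<integral>x. c x \<partial>lborel) = 0"
    using Lw[of "\<lambda>_. 1"] by (simp add: diff_op_1)

  have Ck_left: "Ck_on 2 UNIV (\<lambda>y. v (mul \<alpha> y))" for \<alpha>
    by (rule Ck_on_compose[OF v Ck_mul])
  have cont_Lv: "continuous_on UNIV (diff_op A b v)"
    using Ck_on_diff_op[of 0 v] v by (simp add: numeral_2_eq_2)
  \<comment> \<open>\<open>G\<close> has two readings. With the derivatives on the bump, as here,
    integrability of \<open>v\<close> suffices for Fubini; with them on \<open>v\<close>, as in the
    next fact, the sign is visible.\<close>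
  define G where "G = (\<lambda>\<alpha>. \<integral>y. v (mul \<alpha> y) * c y \<partial>lborel)"
  have G: "G \<alpha> = (\<integral>y. diff_op A b v (mul \<alpha> y) * \<psi> y \<partial>lborel)" for \<alpha>
    unfolding G_def Lw[OF Ck_left, symmetric] diff_op_translate[OF inv Ck_mul v] ..
  have G_nonneg: "0 \<le> G \<alpha>" for \<alpha>
    unfolding G using nonneg \<psi>(2) by (intro Bochner_Integration.integral_nonneg) simp
  \<comment> \<open>The pair is ordered so that the inner integral runs over the translation
    parameter: for fixed \<open>y\<close> this is a right translation, which leaves the L^1 norm of
    \<open>v\<close> unchanged.\<close>
  let ?F = "\<lambda>(y, \<alpha>). v (mul \<alpha> y) * c y"
  have int_F: "integrable (lborel \<Otimes>\<^sub>M lborel) ?F"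
  proof (rule lborel_pair.Fubini_integrable)
    have "continuous_on UNIV ?F"
      unfolding case_prod_unfold
      by (intro continuous_on_mult continuous_on_compose2[OF cont_v] continuous_on_compose2[OF cont_c]
          continuous_on_compose2[OF cont_mul, of UNIV "\<lambda>p. (snd p, fst p)", simplified] continuous_intros) auto
    then show "?F \<in> borel_measurable (lborel \<Otimes>\<^sub>M lborel)"
      unfolding lborel_prod by (simp add: borel_measurable_continuous_onI)
    have "(\<integral>\<alpha>. norm (?F (y, \<alpha>)) \<partial>lborel) = (\<integral>x. \<bar>v x\<bar> \<partial>lborel) * \<bar>c y\<bar>" for y
      by (simp add: abs_mult integral_right_abs)
    then show "integrable lborel (\<lambda>y. \<integral>\<alpha>. norm (?F (y, \<alpha>)) \<partial>lborel)"
      using int_c by simp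
    show "AE y in lborel. integrable lborel (\<lambda>\<alpha>. ?F (y, \<alpha>))"
      using int_right by simp
  qed
  have "(\<integral>\<alpha>. G \<alpha> \<partial>lborel) = (\<integral>y. (\<integral>\<alpha>. v (mul \<alpha> y) * c y \<partial>lborel) \<partial>lborel)"
    unfolding G_def by (rule lborel_pair.Fubini_integral[OF int_F])
  also have "\<dots> = 0"
    by (simp add: integral_right integral_c)
  finally have "(\<integral>\<alpha>. G \<alpha> \<partial>lborel) = 0" .
  moreover have "integrable lborel G"
    unfolding G_def using lborel_pair.integrable_snd[OF int_F] by simp
  ultimately have AE_G: "AE \<alpha> in lborel. G \<alpha> = 0"
    using integral_nonneg_eq_0_iff_AE[of lborel G] G_nonneg by simp

  \<comment> \<open>The integrand is continuous and nonnegative, so it vanishes at the centre of the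
    bump. That centre is the origin, which need not be the identity of the group.\<close>
  have Lv0: "diff_op A b v (mul \<alpha> 0) = 0" if "G \<alpha> = 0" for \<alpha>
  proof -
    let ?h = "\<lambda>y. diff_op A b v (mul \<alpha> y) * \<psi> y"
    have cont_h: "continuous_on UNIV ?h"
      by (intro continuous_on_mult continuous_on_compose2[OF cont_Lv Ck_on_imp_continuous[OF Ck_mul]]
          Ck_on_imp_continuous[OF Ck_\<psi>[of 0]]) auto
    have "?h 0 = 0"
    proof (rule continuous_nonneg_integral_eq_0[OF cont_h])
      show "integrable lborel ?h"
        by (rule integrable_of_compact_support[OF cont_h K(1)]) (simp add: K(2))
      show "0 \<le> ?h y" for y
        using nonneg \<psi>(2) by simp
      show "integral\<^sup>L lborel ?h = 0"
        using that by (simp add: G)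
    qed
    moreover have "\<psi> 0 \<noteq> 0"
      using \<psi>(3)[of 0] by simp
    ultimately show ?thesis
      by simp
  qed
  have "{\<alpha>. diff_op A b v (mul \<alpha> 0) \<noteq> 0} = {}"
  proof (rule open_AE_lborel_empty)
    have "continuous_on UNIV (\<lambda>\<alpha>. diff_op A b v (mul \<alpha> 0))"
      by (rule continuous_on_compose2[OF cont_Lv cont_right]) simp
    then show "open {\<alpha>. diff_op A b v (mul \<alpha> 0) \<noteq> 0}"
      by (intro open_Collect_neq) (auto intro: continuous_on_const)
    show "AE \<alpha> in lborel. \<alpha> \<notin> {\<alpha>. diff_op A b v (mul \<alpha> 0) \<noteq> 0}"
      using AE_G by eventually_elim (simp add: Lv0)
  qed
  \<comment> \<open>Every point \<open>z\<close> is the right translate by 0 of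
    \<open>mul z (iv 0)\<close>, so the sample points cover the whole space.\<close>
  then have "diff_op A b v (mul (mul z (iv 0)) 0) = 0"
    by blast
  then show ?thesis
    by (simp only: right_cancel)
qed

subsection \<open>The consequence of hypoellipticity\<close>

text \<open>If \<eta> = M \<xi> were nonzero, moving a short way from \<xi> in direction -\<eta>
  would make the form negative: the linear term -2 t |\<eta>|^2 beats t^2 times the form at
  \<eta>.\<close>

lemma psd_inner_eq_0_imp:
  fixes M :: "real^'n^'n"
  assumes sym: "\<And>\<xi> \<eta>. (M *v \<xi>) \<bullet> \<eta> = (M *v \<eta>) \<bullet> \<xi>" and nonneg: "\<And>\<xi>. 0 \<le> (M *v \<xi>) \<bullet> \<xi>"
    and zero: "(M *v \<xi>) \<bullet> \<xi> = 0"
  shows "M *v \<xi> = 0"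
proof -
  define \<eta> where "\<eta> = M *v \<xi>"
  define m where "m = (M *v \<eta>) \<bullet> \<eta>"
  \<comment> \<open>The added 1 avoids division by zero and still gives t m \<le> |\<eta>|^2, below
    the 2 |\<eta>|^2 that nonnegativity demands.\<close>
  define t where "t = (\<eta> \<bullet> \<eta>) / (m + 1)"
  have m: "0 \<le> m"
    unfolding m_def by (rule nonneg)
  have "0 \<le> (M *v (\<xi> - t *\<^sub>R \<eta>)) \<bullet> (\<xi> - t *\<^sub>R \<eta>)"
    by (rule nonneg)
  also have "\<dots> = t\<^sup>2 * m - 2 * t * (\<eta> \<bullet> \<eta>)"
  proof -
    have "(M *v \<eta>) \<bullet> \<xi> = \<eta> \<bullet> \<eta>"
      using sym[of \<eta> \<xi>] by (simp add: \<eta>_def)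
    then show ?thesis
      using zero unfolding m_def
      by (simp add: matrix_vector_mult_diff_distrib matrix_vector_mult_scaleR inner_diff_left inner_diff_right
          power2_eq_square algebra_simps flip: \<eta>_def)
  qed
  finally have "t * (2 * (\<eta> \<bullet> \<eta>)) \<le> t * (t * m)"
    by (simp add: power2_eq_square algebra_simps)
  then have le: "2 * (\<eta> \<bullet> \<eta>) \<le> t * m" if "0 < t"
    using that by (simp only: mult_le_cancel_left_pos)
  have "\<eta> \<bullet> \<eta> = 0"
  proof (rule ccontr)
    assume "\<eta> \<bullet> \<eta> \<noteq> 0"
    then have pos: "0 < \<eta> \<bullet> \<eta>"
      using inner_ge_zero[of \<eta>] by linarith
    then have "0 < t"
      using m by (simp add: t_def)
    moreover have "t * m \<le> \<eta> \<bullet> \<eta>"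
      using m pos by (simp add: t_def field_simps)
    ultimately show False
      using le pos by linarith
  qed
  then show ?thesis
    by (simp add: \<eta>_def)
qed

section \<open>Continuous functions as distributions\<close>

lemma continuous_imp_distribution_on:
  fixes w :: "'a::euclidean_space \<Rightarrow> real"
  assumes w: "continuous_on UNIV w"
  shows "distribution_on UNIV (\<lambda>\<phi>. \<integral>x. w x * \<phi> x \<partial>lborel)"
  unfolding distribution_on_def
proof (intro conjI allI impI)
  have int: "integrable lborel (\<lambda>x. w x * \<phi> x)" if \<phi>: "test_function UNIV \<phi>" for \<phi>
  proof -
    obtain K where K: "compact K" "\<And>x. x \<notin> K \<Longrightarrow> \<phi> x = 0"
      by (rule test_functionE[OF \<phi>]) auto
    have "continuous_on UNIV (\<lambda>x. w x * \<phi> x)"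
      by (intro continuous_on_mult w Ck_on_imp_continuous[OF test_function_Ck[OF \<phi>, of 0]])
    then show ?thesis
      by (rule integrable_of_compact_support[OF _ K(1)]) (simp add: K(2))
  qed
  show "(\<integral>x. w x * (\<phi> x + \<psi> x) \<partial>lborel) = (\<integral>x. w x * \<phi> x \<partial>lborel) + (\<integral>x. w x * \<psi> x \<partial>lborel)"
    if "test_function UNIV \<phi>" "test_function UNIV \<psi>" for \<phi> \<psi>
    using int[OF that(1)] int[OF that(2)] by (simp add: distrib_left)
  show "(\<integral>x. w x * (c * \<phi> x) \<partial>lborel) = c * (\<integral>x. w x * \<phi> x \<partial>lborel)" for c \<phi>
    by (simp add: mult.left_commute)
  fix K :: "'a set" assume "compact K \<and> K \<subseteq> UNIV"
  then have K: "compact K" by simp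
  have int_K: "integrable lborel (\<lambda>x. indicator K x * \<bar>w x\<bar>)"
    using borel_integrable_compact[OF K, of "\<lambda>x. \<bar>w x\<bar>"] continuous_on_subset[OF w]
    by (simp add: continuous_on_rabs)
  have bound: "\<bar>\<integral>x. w x * \<phi> x \<partial>lborel\<bar> \<le> (\<integral>x. indicator K x * \<bar>w x\<bar> \<partial>lborel) * (SUP x. \<bar>\<phi> x\<bar>)"
    if \<phi>: "test_function UNIV \<phi>" and supp: "closure (support_on UNIV \<phi>) \<subseteq> K" for \<phi>
  proof -
    have zero: "\<phi> x = 0" if "x \<notin> K" for x
      using that supp closure_subset[of "support_on UNIV \<phi>"] by (auto simp: support_on_def)
    obtain B where "0 \<le> B" and B: "\<And>x. \<bar>\<phi> x\<bar> \<le> B"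
      by (rule bounded_of_compact_support[OF Ck_on_imp_continuous[OF test_function_Ck[OF \<phi>, of 0]] K zero])
        (assumption, rule that)
    \<comment> \<open>A real supremum is known to be an upper bound only for a set bounded above, so
      this is secured first.\<close>
    have bdd: "bdd_above (range (\<lambda>x. \<bar>\<phi> x\<bar>))"
      using B by (intro bdd_aboveI[of _ B]) auto
    have "\<bar>w x * \<phi> x\<bar> \<le> indicator K x * \<bar>w x\<bar> * (SUP x. \<bar>\<phi> x\<bar>)" for x
      using cSUP_upper[OF UNIV_I bdd, of x] zero[of x]
      by (cases "x \<in> K") (auto simp: abs_mult intro: mult_left_mono)
    then have le: "(\<integral>x. \<bar>w x * \<phi> x\<bar> \<partial>lborel) \<le> (\<integral>x. indicator K x * \<bar>w x\<bar> * (SUP x. \<bar>\<phi> x\<bar>) \<partial>lborel)"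
      by (intro integral_mono integrable_abs int[OF \<phi>] integrable_mult_left int_K)
    have "\<bar>\<integral>x. w x * \<phi> x \<partial>lborel\<bar> \<le> (\<integral>x. \<bar>w x * \<phi> x\<bar> \<partial>lborel)"
      using integral_norm_bound[of lborel "\<lambda>x. w x * \<phi> x"] by (simp only: real_norm_def)
    also note le
    finally show ?thesis
      by simp
  qed
  \<comment> \<open>The estimate has order 0: with N = 0 only the empty list remains, and the right
    side is the supremum of |\<phi>| times the integral of |w| over \<open>K\<close>.\<close>
  have "{vs. set vs \<subseteq> (Basis :: 'a set) \<and> length vs \<le> 0} = {[]}"
    by auto
  with bound show "\<exists>C N. \<forall>\<phi>. test_function UNIV \<phi> \<and> closure (support_on UNIV \<phi>) \<subseteq> K \<longrightarrow>
      \<bar>\<integral>x. w x * \<phi> x \<partial>lborel\<bar> \<le> C * (\<Sum>vs | set vs \<subseteq> Basis \<and> length vs \<le> N. SUP x. \<bar>iter_deriv vs \<phi> x\<bar>)"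
    by (intro exI[of _ "\<integral>x. indicator K x * \<bar>w x\<bar> \<partial>lborel"] exI[of _ "0::nat"]) simp
qed

text \<open>A smooth distribution has some smooth density, not yet \<open>w\<close> itself;
  continuity of both forces them to coincide everywhere.\<close>

lemma continuous_smooth_distribution_imp_smooth_on:
  fixes w :: "'a::euclidean_space \<Rightarrow> real"
  assumes w: "continuous_on UNIV w" and smooth: "smooth_distribution_on UNIV (\<lambda>\<phi>. \<integral>x. w x * \<phi> x \<partial>lborel)"
  shows "smooth_on UNIV w"
proof -
  obtain f where f: "smooth_on UNIV f"
    and eq: "\<And>\<phi>. test_function UNIV \<phi> \<Longrightarrow> (\<integral>x. w x * \<phi> x \<partial>lborel) = (LINT x:UNIV|lebesgue. f x * \<phi> x)"
    using smooth unfolding smooth_distribution_on_def by blast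
  have cont_f: "continuous_on UNIV f"
    by (rule Ck_on_imp_continuous[OF smooth_onD[OF f, of 0]])
  have "w a - f a = 0" for a
  proof (rule continuous_eq_0_of_test_functions[where f = "\<lambda>x. w x - f x"])
    show "continuous_on UNIV (\<lambda>x. w x - f x)"
      by (intro continuous_on_diff w cont_f)
    fix \<phi> :: "'a \<Rightarrow> real" assume \<phi>: "test_function UNIV \<phi>"
    have cont_\<phi>: "continuous_on UNIV \<phi>"
      by (rule Ck_on_imp_continuous[OF test_function_Ck[OF \<phi>, of 0]])
    obtain K where K: "compact K" "\<And>x. x \<notin> K \<Longrightarrow> \<phi> x = 0"
      by (rule test_functionE[OF \<phi>]) auto
    have int: "integrable lborel (\<lambda>x. h x * \<phi> x)" if "continuous_on UNIV h" for h
      by (rule integrable_of_compact_support[OF continuous_on_mult[OF that cont_\<phi>] K(1)]) (simp add: K(2))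
    have "(LINT x:UNIV|lebesgue. f x * \<phi> x) = (\<integral>x. f x * \<phi> x \<partial>lborel)"
      using integral_completion[OF borel_measurable_integrable[OF int[OF cont_f]]]
      by (simp add: set_lebesgue_integral_def)
    then show "(\<integral>x. (w x - f x) * \<phi> x \<partial>lborel) = 0"
      using eq[OF \<phi>] int[OF w] int[OF cont_f] by (simp add: left_diff_distrib)
  qed
  then have "w = f"
    by (intro ext) simp
  with f show ?thesis
    by simp
qed

text \<open>The absolute value has a minimum at \<open>x\<close>, so its derivative there is zero.
  Then u y - u x is o(|y - x|), which says that \<open>u\<close> has derivative zero.\<close>

lemma abs_diff_differentiable_imp:
  fixes u :: "'a::euclidean_space \<Rightarrow> real"
  assumes "(\<lambda>y. \<bar>u y - u x\<bar>) differentiable (at x)"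
  shows "(u has_derivative (\<lambda>_. 0)) (at x)"
proof -
  obtain D where D: "((\<lambda>y. \<bar>u y - u x\<bar>) has_derivative D) (at x)"
    using assms by (auto simp: differentiable_def)
  have "D = (\<lambda>_. 0)"
    by (rule differential_zero_maxmin[OF UNIV_I open_UNIV D]) simp
  with D show ?thesis
    by (simp add: has_derivative_iff_norm)
qed

text \<open>Supplies a function that is C^1 but not twice differentiable at 0, the defect that
  hypoellipticity will be played against.\<close>

lemma DERIV_mult_abs: "((\<lambda>t. t * \<bar>t\<bar>) has_real_derivative 2 * \<bar>t\<bar>) (at t)"
proof -
  consider "t < 0" | "t = 0" | "0 < t" by linarith
  then show ?thesis
  proof cases
    case 1
    have "((\<lambda>t. - (t * t)) has_real_derivative 2 * \<bar>t\<bar>) (at t)"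
      using 1 by (auto intro!: derivative_eq_intros)
    then show ?thesis
      by (rule has_field_derivative_transform_within_open[where S = "{..<0}"]) (use 1 in auto)
  next
    case 2
    have "((\<lambda>h. h * \<bar>h\<bar> / h) \<longlongrightarrow> 0) (at (0::real))"
    proof (rule Lim_transform_eventually)
      show "(abs \<longlongrightarrow> 0) (at (0::real))"
        using tendsto_rabs[OF tendsto_ident_at, of 0] by simp
      show "\<forall>\<^sub>F h in at 0. \<bar>h\<bar> = h * \<bar>h\<bar> / (h :: real)"
        unfolding eventually_at by (intro exI[of _ 1]) simp
    qed
    with 2 show ?thesis
      by (simp add: DERIV_def)
  next
    case 3
    have "((\<lambda>t. t * t) has_real_derivative 2 * \<bar>t\<bar>) (at t)"
      using 3 by (auto intro!: derivative_eq_intros)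
    then show ?thesis
      by (rule has_field_derivative_transform_within_open[where S = "{0<..}"]) (use 3 in auto)
  qed
qed

text \<open>
  If \<open>A \<nabla>u = 0\<close> and \<open>b \<bullet> \<nabla>u = 0\<close>, then every function of \<open>u\<close> is annihilated by the operator, so
  hypoellipticity forces \<open>(u - c) \<bar>u - c\<bar>\<close> to be smooth. This is impossible where \<open>u = c\<close> and
  \<open>\<nabla>u \<noteq> 0\<close>.
\<close>
lemma (in smooth_coefficients) hypoelliptic_imp_grad_eq_0:
  assumes hypo: "hypoelliptic A b" and u: "Ck_on 2 UNIV u"
    and A_grad: "\<And>x. A x *v grad u x = 0" and b_grad: "\<And>x. b x \<bullet> grad u x = 0"
  shows "grad u x = 0"
proof (rule ccontr)
  assume "grad u x \<noteq> 0"
  then obtain i where i: "pd i u x \<noteq> 0"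
    by (auto simp: vec_eq_iff)
  define w where "w = (\<lambda>y. (u y - u x) * \<bar>u y - u x\<bar>)"
  have du: "u differentiable (at y)" for y
    by (rule Ck_on_2_pd(1)[OF u])
  have w_deriv: "(w has_derivative (\<lambda>v. dir_deriv v u y * (2 * \<bar>u y - u x\<bar>))) (at y)" for y
  proof -
    have "((\<lambda>y. u y - u x) has_derivative (\<lambda>v. dir_deriv v u y)) (at y)"
      using has_derivative_diff[OF has_derivative_dir_deriv[OF du] has_derivative_const] by simp
    from DERIV_compose_FDERIV[OF DERIV_mult_abs this] show ?thesis
      unfolding w_def .
  qed
  have dir_w: "dir_deriv v w = (\<lambda>y. dir_deriv v u y * (2 * \<bar>u y - u x\<bar>))" for v
    by (intro ext dir_deriv_eqI[OF w_deriv])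
  have cont_u: "continuous_on UNIV u"
    by (rule Ck_on_imp_continuous[OF u])
  have w1: "Ck_on (Suc 0) UNIV w"
  proof -
    have "continuous_on UNIV (dir_deriv v w)" if "v \<in> Basis" for v
    proof -
      have "continuous_on UNIV (dir_deriv v u)"
        using u that by (simp add: numeral_2_eq_2 Ck_on_imp_continuous[where k = "Suc 0", simplified])
      then show ?thesis
        unfolding dir_w by (intro continuous_intros cont_u)
    qed
    then show ?thesis
      using w_deriv by (auto simp: differentiable_def)
  qed
  have cont_w: "continuous_on UNIV w"
    by (rule Ck_on_imp_continuous[OF w1])
  have grad_w: "grad w y = (2 * \<bar>u y - u x\<bar>) *\<^sub>R grad u y" for y
    by (simp add: vec_eq_iff dir_w)
  \<comment> \<open>The gradient of \<open>w\<close> is a multiple of that of \<open>u\<close>, so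
    both terms of the weak form vanish pointwise.\<close>
  have weak: "(\<integral>x. w x * diff_op_adjoint A b \<phi> x \<partial>lborel) = 0" if \<phi>: "test_function UNIV \<phi>" for \<phi>
  proof -
    obtain K where K: "compact K" "\<And>x. x \<notin> K \<Longrightarrow> \<phi> x = 0"
      by (rule test_functionE[OF \<phi>]) auto
    show ?thesis
      by (rule trans[OF integral_mult_diff_op_adjoint[OF w1 test_function_Ck[OF \<phi>] K]])
        (simp_all add: grad_w matrix_vector_mult_scaleR A_grad b_grad)
  qed
  have "smooth_distribution_on UNIV (diff_op_distr A b (\<lambda>\<phi>. \<integral>x. w x * \<phi> x \<partial>lborel))"
    unfolding smooth_distribution_on_def diff_op_distr_def
    by (intro exI[of _ "\<lambda>_. 0"]) (simp add: weak smooth_on_def set_lebesgue_integral_def)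
  then have "smooth_distribution_on UNIV (\<lambda>\<phi>. \<integral>x. w x * \<phi> x \<partial>lborel)"
    using hypo continuous_imp_distribution_on[OF cont_w] open_UNIV unfolding hypoelliptic_def by blast
  then have "smooth_on UNIV w"
    by (rule continuous_smooth_distribution_imp_smooth_on[OF cont_w])
  then have "Ck_on 2 UNIV w"
    by (rule smooth_onD)
  then have "pd i w differentiable (at x)"
    by (rule Ck_on_2_pd(3))
  \<comment> \<open>Dividing \<open>pd i w\<close> by twice \<open>pd i u\<close> isolates the
    nonsmooth factor |u - u x|. The identity holds where \<open>pd i u\<close> is nonzero, an open
    set around \<open>x\<close>.\<close>
  then have "(\<lambda>y. pd i w y / (2 * pd i u y)) differentiable (at x)"
    using i by (intro differentiable_divide differentiable_mult differentiable_const Ck_on_2_pd(3)[OF u]) auto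
  then obtain D where D: "((\<lambda>y. pd i w y / (2 * pd i u y)) has_derivative D) (at x)"
    by (auto simp: differentiable_def)
  have "open {y. pd i u y \<noteq> 0}"
    by (intro open_Collect_neq continuous_on_const Ck_on_imp_continuous[OF Ck_on_2_pd(2)[OF u]])
  then have "((\<lambda>y. \<bar>u y - u x\<bar>) has_derivative D) (at x)"
    by (rule has_derivative_transform_within_open[OF D]) (use i in \<open>auto simp: dir_w\<close>)
  then have "(u has_derivative (\<lambda>_. 0)) (at x)"
    by (intro abs_diff_differentiable_imp) (auto simp: differentiable_def)
  from dir_deriv_eqI[OF this] i show False
    by blast
qed

lemma constant_if_grad_eq_0:
  fixes u :: "real^'n \<Rightarrow> real"
  assumes diff: "\<And>x. u differentiable (at x)" and grad: "\<And>x. grad u x = 0"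
  shows "\<exists>c. \<forall>x. u x = c"
proof -
  have "pd i u x = 0" for i x
    using arg_cong[OF grad[of x], of "\<lambda>g. g $ i"] by simp
  then have "dir_deriv v u x = 0" for v x
    by (subst dir_deriv_eq_sum_Basis[OF diff]) (simp add: sum_Basis_vec)
  then have "(u has_derivative (\<lambda>_. 0)) (at x)" for x
    using has_derivative_dir_deriv[OF diff, of x] by simp
  then show ?thesis
    using has_derivative_zero_constant[OF convex_UNIV, of u] by auto
qed

text \<open>Since grad (u^2) = 2 u grad u, the drift only acquires the factor 2 u, while the
  divergence also differentiates that factor; this yields the extra quadratic form.\<close>

lemma (in smooth_coefficients) diff_op_square:
  assumes u: "Ck_on 2 UNIV u"
  shows "diff_op A b (\<lambda>x. u x * u x) x = 2 * u x * diff_op A b u x + 2 * ((A x *v grad u x) \<bullet> grad u x)"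
proof -
  have du: "u differentiable (at x)" for x
    by (rule Ck_on_2_pd(1)[OF u])
  have dflux: "(\<lambda>y. (A y *v grad u y) $ i) differentiable (at x)" for x i
    using Ck_on_flux[of "Suc 0" u i] u by (simp add: numeral_2_eq_2)
  have grad_sq: "grad (\<lambda>x. u x * u x) y = (2 * u y) *\<^sub>R grad u y" for y
    unfolding grad_mult[OF du du] by (simp flip: scaleR_left_distrib)
  have grad_2: "grad (\<lambda>y. 2 * u y) x = 2 *\<^sub>R grad u x"
    using grad_mult[OF differentiable_const du, of 2 x] by (simp add: vec_eq_iff)
  have d2: "(\<lambda>y. 2 * u y) differentiable (at x)"
    by (intro differentiable_mult differentiable_const du)
  show ?thesis
    unfolding diff_op_def grad_sq matrix_vector_mult_scaleR divergence_scaleR[OF d2 dflux] grad_2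
    by (simp add: inner_commute algebra_simps)
qed

theorem corollary1p6:
  fixes A :: "real^'n \<Rightarrow> real^'n^'n"
    and b :: "real^'n \<Rightarrow> real^'n"
    and mul :: "real^'n \<Rightarrow> real^'n \<Rightarrow> real^'n"
    and lam :: real
    and u :: "real^'n \<Rightarrow> real"
  assumes A_smooth: "\<And>i j. smooth_on UNIV (\<lambda>x. A x $ i $ j)"
    and b_smooth: "\<And>j. smooth_on UNIV (\<lambda>x. b x $ j)"
    and A_sym: "\<And>x. transpose (A x) = A x"
    and A_nonneg: "\<And>x \<xi>. (A x *v \<xi>) \<bullet> \<xi> \<ge> 0"
    and A_trace: "trace (A 0) > 0"
    and hypo: "hypoelliptic A b"
    and lie: "lie_group mul"
    and inv: "left_translation_invariant mul (diff_op A b)"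
    and haar_left: "left_invariant_measure mul lebesgue"
    and haar_right: "right_invariant_measure mul lebesgue"
    and lam_nonneg: "lam \<ge> 0"
    and u_C2: "Ck_on 2 UNIV u"
    and u_L2: "square_integrable lebesgue u"
    and eigen: "\<And>x. diff_op A b u x = lam * u x"
  shows "\<forall>x. u x = 0"
proof -
  interpret smooth_coefficients A b
    by standard (rule A_smooth b_smooth A_sym)+
  obtain e iv where grp: "group mul e iv" and mul_smooth: "smooth_on UNIV (\<lambda>(x, y). mul x y)"
    using lie unfolding lie_group_def by blast
  let ?v = "\<lambda>x. u x * u x"
  have meas_u: "u \<in> borel_measurable borel"
    by (rule borel_measurable_continuous_onI[OF Ck_on_imp_continuous[OF u_C2]])
  have int_v: "integrable lborel ?v"
    using u_L2 meas_u unfolding square_integrable_def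
    by (simp add: integrable_completion power2_eq_square)
  have v: "Ck_on 2 UNIV ?v"
    by (intro Ck_on_mult u_C2)
  have Lv: "diff_op A b ?v x = 2 * (lam * (u x)\<^sup>2) + 2 * ((A x *v grad u x) \<bullet> grad u x)" for x
    unfolding diff_op_square[OF u_C2] eigen by (simp add: power2_eq_square)
  have nonneg: "0 \<le> lam * (u x)\<^sup>2" "0 \<le> (A x *v grad u x) \<bullet> grad u x" for x
    using lam_nonneg A_nonneg by simp_all
  have Lv_0: "diff_op A b ?v x = 0" for x
    by (rule diff_op_eq_0_of_nonneg[OF grp mul_smooth inv haar_right v int_v])
      (simp add: Lv nonneg)
  have zero: "lam * (u x)\<^sup>2 = 0" "(A x *v grad u x) \<bullet> grad u x = 0" for x
  proof -
    have "2 * (lam * (u x)\<^sup>2) + 2 * ((A x *v grad u x) \<bullet> grad u x) = 0"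
      using Lv_0[of x] Lv[of x] by simp
    with nonneg[of x] show "lam * (u x)\<^sup>2 = 0" "(A x *v grad u x) \<bullet> grad u x = 0"
      by linarith+
  qed
  show ?thesis
  proof (cases "lam = 0")
    case False
    with zero(1) show ?thesis by simp
  next
    case True
    have A_grad: "A x *v grad u x = 0" for x
      using A_inner_commute A_nonneg zero(2) by (rule psd_inner_eq_0_imp)
    \<comment> \<open>\<open>A\<close> times the gradient is zero everywhere, not just at one point,
      so its divergence drops out of the equation.\<close>
    have b_grad: "b x \<bullet> grad u x = 0" for x
      using eigen[of x] True by (simp add: diff_op_def A_grad divergence_def)
    have "grad u x = 0" for x
      by (rule hypoelliptic_imp_grad_eq_0[OF hypo u_C2 A_grad b_grad])
    then obtain c where c: "\<And>x. u x = c"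
      using constant_if_grad_eq_0[OF Ck_on_2_pd(1)[OF u_C2]] by blast
    \<comment> \<open>The whole space has infinite measure, so the constant \<open>c * c\<close> is
      integrable only if it is zero.\<close>
    have "(\<integral>\<^sup>+ x. ennreal (norm (c * c)) \<partial>(lborel :: (real^'n) measure)) < \<infinity>"
      using int_v unfolding c integrable_iff_bounded by blast
    then have "c = 0"
      by (simp add: ennreal_mult_eq_top_iff less_top[symmetric] split: if_splits)
    with c show ?thesis by simp
  qed
qed

end
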